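(* Let $\mathcal A$ be a category with finite products and finite coproducts, equipped with a model structure $(\mathsf{Cofib},\mathsf{Fib},\mathsf{Weq})$, and let $I$ be a (small) set, regarded as a discrete indexing category. Let $$\gamma:\mathcal A\to\operatorname{Ho}(\mathcal A)=\mathcal A[\mathsf{Weq}^{-1}],\qquad\gamma_I:\mathcal A^I\to\operatorname{Ho}(\mathcal A^I)=(\mathcal A^I)[(\mathsf{Weq}^I)^{-1}]$$ be the localizations. Then the canonical functor obtained by factoring $\gamma^I$ through $\gamma_I$, $$\Theta_I:\operatorname{Ho}(\mathcal A^I)\longrightarrow(\operatorname{Ho}(\mathcal A))^I,\qquad\Theta_I\circ\gamma_I=\gamma^I,$$ is an isomorphism of categories. Equivalently, for any two families of objects $X=(X_i)_{i\in I}$ and $Y=(Y_i)_{i\in I}$ of $\mathcal A$, the canonical map $$\operatorname{Hom}_{\operatorname{Ho}(\mathcal A^I)}(\gamma_IX,\gamma_IY)\longrightarrow\prod_{i\in I}\operatorname{Hom}_{\operatorname{Ho}(\mathcal A)}(\gamma X_i,\gamma Y_i)$$ is a bijection.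
   Context: Size issues are ignored (or handled by universes). For a category $\mathcal B$ and a class $S$ of morphisms, the Gabriel--Zisman localization $\mathcal B\to\mathcal B[S^{-1}]$ sends $S$ to isomorphisms, and every functor out of $\mathcal B$ sending $S$ to isomorphisms factors uniquely (on the nose) through it; it is taken in its standard construction, with $\mathsf{Ob}(\mathcal B[S^{-1}])=\mathsf{Ob}(\mathcal B)$. $\mathcal A^I$ is the product category $\prod_{i\in I}\mathcal A$, $\mathsf{Weq}^I$ is the class of families $(w_i)_{i\in I}$ with all $w_i\in\mathsf{Weq}$, and $\gamma^I=\prod_{i\in I}\gamma$. A model structure on $\mathcal A$ consists of three classes of morphisms $(\mathsf{Cofib},\mathsf{Fib},\mathsf{Weq})$, each containing all identity morphisms and closed under composition, such that, with $\mathsf{TCofib}=\mathsf{Cofib}\cap\mathsf{Weq}$ and $\mathsf{TFib}=\mathsf{Fib}\cap\mathsf{Weq}$: (CM1) for every composable pair, if two of $f,g,g\circ f$ are in $\mathsf{Weq}$, so is the third; (CM2) each of the three classes is closed under retracts in the arrow category; (CM3) for every commutative square $p\circ a=b\circ i$ with $i:X\to Y$, $p:E\to B$, $a:X\to E$, $b:Y\to B$, if either $i\in\mathsf{Cofib}$ and $p\in\mathsf{TFib}$, or $i\in\mathsf{TCofib}$ and $p\in\mathsf{Fib}$, there is $h:Y\to E$ with $h\circ i=a$ and $p\circ h=b$; (CM4) every morphism $f$ factors as $f=p\circ i$ with $i\in\mathsf{Cofib}$, $p\in\mathsf{TFib}$, and also as $f=p'\circ i'$ with $i'\in\mathsf{TCofib}$,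 $p'\in\mathsf{Fib}$. The factorizations are not required to be functorial, and no limits or colimits beyond finite products and finite coproducts are assumed. *)

theory Defs
  imports "HOL-Library.FuncSet"
begin

section \<open>Categories and functors\<close>

record ('o, 'm) cat =
  Ob :: "'o set"
  Arr :: "'m set"
  Dom :: "'m \<Rightarrow> 'o"
  Cod :: "'m \<Rightarrow> 'o"
  Idn :: "'o \<Rightarrow> 'm"
  Comp :: "'m \<Rightarrow> 'm \<Rightarrow> 'm"  (infixl \<open>\<cdot>\<index>\<close> 70)

text \<open>Composition is in applicative order: \<open>g \<cdot>\<^bsub>C\<^esub> f\<close> is meaningful when \<open>Cod C f = Dom C g\<close>.\<close>

definition hom :: "('o, 'm) cat \<Rightarrow> 'o \<Rightarrow> 'o \<Rightarrow> 'm set" where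
  "hom C X Y = {f \<in> Arr C. Dom C f = X \<and> Cod C f = Y}"

locale category =
  fixes C :: "('o, 'm) cat" (structure)
  assumes dom_in: "f \<in> Arr C \<Longrightarrow> Dom C f \<in> Ob C"
    and cod_in: "f \<in> Arr C \<Longrightarrow> Cod C f \<in> Ob C"
    and idn_hom: "X \<in> Ob C \<Longrightarrow> Idn C X \<in> hom C X X"
    and comp_hom: "f \<in> hom C X Y \<Longrightarrow> g \<in> hom C Y Z \<Longrightarrow> g \<cdot> f \<in> hom C X Z"
    and idn_right: "f \<in> hom C X Y \<Longrightarrow> f \<cdot> Idn C X = f"
    and idn_left: "f \<in> hom C X Y \<Longrightarrow> Idn C Y \<cdot> f = f"
    and assoc: "f \<in> hom C W X \<Longrightarrow> g \<in> hom C X Y \<Longrightarrow> h \<in> hom C Y Z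
                  \<Longrightarrow> (h \<cdot> g) \<cdot> f = h \<cdot> (g \<cdot> f)"

definition is_iso :: "('o, 'm) cat \<Rightarrow> 'm \<Rightarrow> bool" where
  "is_iso C f \<longleftrightarrow> f \<in> Arr C \<and> (\<exists>g \<in> hom C (Cod C f) (Dom C f).
     g \<cdot>\<^bsub>C\<^esub> f = Idn C (Dom C f) \<and> f \<cdot>\<^bsub>C\<^esub> g = Idn C (Cod C f))"

record ('o, 'm, 'p, 'n) func =
  fobj :: "'o \<Rightarrow> 'p"
  farr :: "'m \<Rightarrow> 'n"

text \<open>The object and arrow maps of a functor are extensional (\<open>undefined\<close> off the source
  category), so that equality of functors is equality in HOL.\<close>

definition is_functor ::
    "('o, 'm) cat \<Rightarrow> ('p, 'n) cat \<Rightarrow> ('o, 'm, 'p, 'n) func \<Rightarrow> bool" where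
  "is_functor C D F \<longleftrightarrow> category C \<and> category D \<and>
     fobj F \<in> Ob C \<rightarrow>\<^sub>E Ob D \<and> farr F \<in> Arr C \<rightarrow>\<^sub>E Arr D \<and>
     (\<forall>f \<in> Arr C. Dom D (farr F f) = fobj F (Dom C f) \<and> Cod D (farr F f) = fobj F (Cod C f)) \<and>
     (\<forall>X \<in> Ob C. farr F (Idn C X) = Idn D (fobj F X)) \<and>
     (\<forall>f \<in> Arr C. \<forall>g \<in> Arr C. Cod C f = Dom C g \<longrightarrow>
        farr F (g \<cdot>\<^bsub>C\<^esub> f) = farr F g \<cdot>\<^bsub>D\<^esub> farr F f)"

definition id_functor :: "('o, 'm) cat \<Rightarrow> ('o, 'm, 'o, 'm) func" where
  "id_functor C = \<lparr>fobj = \<lambda>X\<in>Ob C. X, farr = \<lambda>f\<in>Arr C. f\<rparr>"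

definition comp_functor :: "('o, 'm) cat \<Rightarrow> ('p, 'n, 'q, 'k) func \<Rightarrow> ('o, 'm, 'p, 'n) func
    \<Rightarrow> ('o, 'm, 'q, 'k) func" where
  "comp_functor C G F =
     \<lparr>fobj = compose (Ob C) (fobj G) (fobj F), farr = compose (Arr C) (farr G) (farr F)\<rparr>"

definition is_cat_iso ::
    "('o, 'm) cat \<Rightarrow> ('p, 'n) cat \<Rightarrow> ('o, 'm, 'p, 'n) func \<Rightarrow> bool" where
  "is_cat_iso C D F \<longleftrightarrow> is_functor C D F \<and>
     (\<exists>G. is_functor D C G \<and> comp_functor C G F = id_functor C \<and> comp_functor D F G = id_functor D)"

section \<open>Finite products and coproducts\<close>

definition is_product ::
    "('o, 'm) cat \<Rightarrow> 'j set \<Rightarrow> ('j \<Rightarrow> 'o) \<Rightarrow> 'o \<Rightarrow> ('j \<Rightarrow> 'm) \<Rightarrow> bool" where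
  "is_product C J X P \<pi> \<longleftrightarrow> P \<in> Ob C \<and> (\<forall>j\<in>J. \<pi> j \<in> hom C P (X j)) \<and>
     (\<forall>T \<in> Ob C. \<forall>t. (\<forall>j\<in>J. t j \<in> hom C T (X j)) \<longrightarrow>
        (\<exists>!u. u \<in> hom C T P \<and> (\<forall>j\<in>J. \<pi> j \<cdot>\<^bsub>C\<^esub> u = t j)))"

definition is_coproduct ::
    "('o, 'm) cat \<Rightarrow> 'j set \<Rightarrow> ('j \<Rightarrow> 'o) \<Rightarrow> 'o \<Rightarrow> ('j \<Rightarrow> 'm) \<Rightarrow> bool" where
  "is_coproduct C J X P \<iota> \<longleftrightarrow> P \<in> Ob C \<and> (\<forall>j\<in>J. \<iota> j \<in> hom C (X j) P) \<and>
     (\<forall>T \<in> Ob C. \<forall>t. (\<forall>j\<in>J. t j \<in> hom C (X j) T) \<longrightarrow>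
        (\<exists>!u. u \<in> hom C P T \<and> (\<forall>j\<in>J. u \<cdot>\<^bsub>C\<^esub> \<iota> j = t j)))"

definition has_finite_products :: "('o, 'm) cat \<Rightarrow> bool" where
  "has_finite_products C \<longleftrightarrow>
     (\<forall>n::nat. \<forall>X \<in> {..<n} \<rightarrow> Ob C. \<exists>P \<pi>. is_product C {..<n} X P \<pi>)"

definition has_finite_coproducts :: "('o, 'm) cat \<Rightarrow> bool" where
  "has_finite_coproducts C \<longleftrightarrow>
     (\<forall>n::nat. \<forall>X \<in> {..<n} \<rightarrow> Ob C. \<exists>P \<iota>. is_coproduct C {..<n} X P \<iota>)"

section \<open>Model structures\<close>

definition is_retract :: "('o, 'm) cat \<Rightarrow> 'm \<Rightarrow> 'm \<Rightarrow> bool" where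
  "is_retract C f g \<longleftrightarrow>
     (\<exists>i \<in> hom C (Dom C f) (Dom C g). \<exists>r \<in> hom C (Dom C g) (Dom C f).
      \<exists>j \<in> hom C (Cod C f) (Cod C g). \<exists>s \<in> hom C (Cod C g) (Cod C f).
        g \<cdot>\<^bsub>C\<^esub> i = j \<cdot>\<^bsub>C\<^esub> f \<and> f \<cdot>\<^bsub>C\<^esub> r = s \<cdot>\<^bsub>C\<^esub> g \<and>
        r \<cdot>\<^bsub>C\<^esub> i = Idn C (Dom C f) \<and> s \<cdot>\<^bsub>C\<^esub> j = Idn C (Cod C f))"

definition has_lifting :: "('o, 'm) cat \<Rightarrow> 'm \<Rightarrow> 'm \<Rightarrow> bool" where
  "has_lifting C i p \<longleftrightarrow>
     (\<forall>a \<in> hom C (Dom C i) (Dom C p). \<forall>b \<in> hom C (Cod C i) (Cod C p).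
        p \<cdot>\<^bsub>C\<^esub> a = b \<cdot>\<^bsub>C\<^esub> i \<longrightarrow>
        (\<exists>h \<in> hom C (Cod C i) (Dom C p). h \<cdot>\<^bsub>C\<^esub> i = a \<and> p \<cdot>\<^bsub>C\<^esub> h = b))"

definition wide_subcategory :: "('o, 'm) cat \<Rightarrow> 'm set \<Rightarrow> bool" where
  "wide_subcategory C S \<longleftrightarrow> S \<subseteq> Arr C \<and> (\<forall>X \<in> Ob C. Idn C X \<in> S) \<and>
     (\<forall>f \<in> S. \<forall>g \<in> S. Cod C f = Dom C g \<longrightarrow> g \<cdot>\<^bsub>C\<^esub> f \<in> S)"

definition retract_closed :: "('o, 'm) cat \<Rightarrow> 'm set \<Rightarrow> bool" where
  "retract_closed C S \<longleftrightarrow> (\<forall>f \<in> Arr C. \<forall>g \<in> S. is_retract C f g \<longrightarrow> f \<in> S)"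

definition two_of_three :: "('o, 'm) cat \<Rightarrow> 'm set \<Rightarrow> bool" where
  "two_of_three C S \<longleftrightarrow> (\<forall>f \<in> Arr C. \<forall>g \<in> Arr C. Cod C f = Dom C g \<longrightarrow>
     (f \<in> S \<and> g \<in> S \<longrightarrow> g \<cdot>\<^bsub>C\<^esub> f \<in> S) \<and>
     (f \<in> S \<and> g \<cdot>\<^bsub>C\<^esub> f \<in> S \<longrightarrow> g \<in> S) \<and>
     (g \<in> S \<and> g \<cdot>\<^bsub>C\<^esub> f \<in> S \<longrightarrow> f \<in> S))"

locale model_structure = category C
  for C :: "('o, 'm) cat" (structure) +
  fixes Cofib Fib Weq :: "'m set"
  assumes wide: "wide_subcategory C Cofib" "wide_subcategory C Fib" "wide_subcategory C Weq"
    and CM1: "two_of_three C Weq"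
    and CM2: "retract_closed C Cofib" "retract_closed C Fib" "retract_closed C Weq"
    and CM3: "i \<in> Cofib \<Longrightarrow> p \<in> Fib \<inter> Weq \<Longrightarrow> has_lifting C i p"
      "i \<in> Cofib \<inter> Weq \<Longrightarrow> p \<in> Fib \<Longrightarrow> has_lifting C i p"
    and CM4:
      "f \<in> Arr C \<Longrightarrow> \<exists>i \<in> Cofib. \<exists>p \<in> Fib \<inter> Weq. Cod C i = Dom C p \<and> f = p \<cdot> i"
      "f \<in> Arr C \<Longrightarrow> \<exists>i \<in> Cofib \<inter> Weq. \<exists>p \<in> Fib. Cod C i = Dom C p \<and> f = p \<cdot> i"

section \<open>Powers of a category\<close>

definition power_cat :: "'i set \<Rightarrow> ('o, 'm) cat \<Rightarrow> ('i \<Rightarrow> 'o, 'i \<Rightarrow> 'm) cat" where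
  "power_cat I C =
     \<lparr>Ob = I \<rightarrow>\<^sub>E Ob C,
      Arr = I \<rightarrow>\<^sub>E Arr C,
      Dom = (\<lambda>f. \<lambda>i\<in>I. Dom C (f i)),
      Cod = (\<lambda>f. \<lambda>i\<in>I. Cod C (f i)),
      Idn = (\<lambda>X. \<lambda>i\<in>I. Idn C (X i)),
      Comp = (\<lambda>g f. \<lambda>i\<in>I. g i \<cdot>\<^bsub>C\<^esub> f i)\<rparr>"

definition power_arrows :: "'i set \<Rightarrow> 'm set \<Rightarrow> ('i \<Rightarrow> 'm) set" where
  "power_arrows I S = (I \<rightarrow>\<^sub>E S)"

definition power_functor :: "'i set \<Rightarrow> ('o, 'm) cat \<Rightarrow> ('o, 'm, 'p, 'n) func
    \<Rightarrow> ('i \<Rightarrow> 'o, 'i \<Rightarrow> 'm, 'i \<Rightarrow> 'p, 'i \<Rightarrow> 'n) func" where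
  "power_functor I C F =
     \<lparr>fobj = \<lambda>X \<in> Ob (power_cat I C). \<lambda>i\<in>I. fobj F (X i),
      farr = \<lambda>f \<in> Arr (power_cat I C). \<lambda>i\<in>I. farr F (f i)\<rparr>"

section \<open>Gabriel--Zisman localization\<close>

text \<open>The localization of \<open>B\<close> at \<open>S\<close> has the objects of \<open>B\<close>; its arrows are zigzags modulo the
  least congruence that makes forward steps functorial and every backward step along \<open>s \<in> S\<close>
  a two-sided inverse of the forward step along \<open>s\<close>. A zigzag is a list of steps in the order in
  which they are traversed: \<open>Fwd f\<close> goes from \<open>Dom f\<close> to \<open>Cod f\<close> and \<open>Bwd s\<close> from \<open>Cod s\<close> to
  \<open>Dom s\<close>.\<close>

datatype 'm step = Fwd 'm | Bwd 'm

fun zigzag :: "('o, 'm) cat \<Rightarrow> 'm set \<Rightarrow> 'o \<Rightarrow> 'm step list \<Rightarrow> 'o \<Rightarrow> bool" where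
  "zigzag B S X [] Y \<longleftrightarrow> X \<in> Ob B \<and> X = Y"
| "zigzag B S X (Fwd f # p) Y \<longleftrightarrow> f \<in> Arr B \<and> Dom B f = X \<and> zigzag B S (Cod B f) p Y"
| "zigzag B S X (Bwd s # p) Y \<longleftrightarrow> s \<in> S \<and> Cod B s = X \<and> zigzag B S (Dom B s) p Y"

inductive zz_eq ::
    "('o, 'm) cat \<Rightarrow> 'm set \<Rightarrow> 'o \<Rightarrow> 'm step list \<Rightarrow> 'm step list \<Rightarrow> 'o \<Rightarrow> bool"
  for B :: "('o, 'm) cat" and S :: "'m set" where
  zz_refl: "zigzag B S X p Y \<Longrightarrow> zz_eq B S X p p Y"
| zz_sym: "zz_eq B S X p q Y \<Longrightarrow> zz_eq B S X q p Y"
| zz_trans: "zz_eq B S X p q Y \<Longrightarrow> zz_eq B S X q r Y \<Longrightarrow> zz_eq B S X p r Y"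
| zz_append: "zz_eq B S X p p' Y \<Longrightarrow> zz_eq B S Y q q' Z \<Longrightarrow> zz_eq B S X (p @ q) (p' @ q') Z"
| zz_idn: "X \<in> Ob B \<Longrightarrow> zz_eq B S X [Fwd (Idn B X)] [] X"
| zz_comp: "f \<in> hom B X Y \<Longrightarrow> g \<in> hom B Y Z \<Longrightarrow> zz_eq B S X [Fwd f, Fwd g] [Fwd (g \<cdot>\<^bsub>B\<^esub> f)] Z"
| zz_fwd_bwd: "s \<in> S \<Longrightarrow> s \<in> hom B X Y \<Longrightarrow> zz_eq B S X [Fwd s, Bwd s] [] X"
| zz_bwd_fwd: "s \<in> S \<Longrightarrow> s \<in> hom B X Y \<Longrightarrow> zz_eq B S Y [Bwd s, Fwd s] [] Y"

text \<open>An arrow of the localization records its source and target next to the class of zigzags.\<close>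

type_synonym ('o, 'm) zz_arrow = "'o \<times> 'm step list set \<times> 'o"

definition zz_class ::
    "('o, 'm) cat \<Rightarrow> 'm set \<Rightarrow> 'o \<Rightarrow> 'm step list \<Rightarrow> 'o \<Rightarrow> ('o, 'm) zz_arrow" where
  "zz_class B S X p Y = (X, {q. zz_eq B S X p q Y}, Y)"

definition localization :: "('o, 'm) cat \<Rightarrow> 'm set \<Rightarrow> ('o, ('o, 'm) zz_arrow) cat" where
  "localization B S =
     \<lparr>Ob = Ob B,
      Arr = {zz_class B S X p Y | X p Y. zigzag B S X p Y},
      Dom = (\<lambda>(X, P, Y). X),
      Cod = (\<lambda>(X, P, Y). Y),
      Idn = (\<lambda>X. zz_class B S X [] X),
      Comp = (\<lambda>(Y', Q, Z) (X, P, Y). (X, {r. \<exists>p\<in>P. \<exists>q\<in>Q. zz_eq B S X (p @ q) r Z}, Z))\<rparr>"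

definition loc_functor ::
    "('o, 'm) cat \<Rightarrow> 'm set \<Rightarrow> ('o, 'm, 'o, ('o, 'm) zz_arrow) func" where
  "loc_functor B S =
     \<lparr>fobj = \<lambda>X \<in> Ob B. X,
      farr = \<lambda>f \<in> Arr B. zz_class B S (Dom B f) [Fwd f] (Cod B f)\<rparr>"

text \<open>The unique functor out of \<open>localization B S\<close> through which \<open>F\<close> factors; existence and
  uniqueness, for \<open>F\<close> inverting \<open>S\<close>, are proved in \<open>localization_universal\<close> below.\<close>

definition loc_factor :: "('o, 'm) cat \<Rightarrow> 'm set \<Rightarrow> ('p, 'n) cat \<Rightarrow> ('o, 'm, 'p, 'n) func
    \<Rightarrow> ('o, ('o, 'm) zz_arrow, 'p, 'n) func" where
  "loc_factor B S D F =
     (THE G. is_functor (localization B S) D G \<and> comp_functor B G (loc_functor B S) = F)"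

section \<open>The comparison functor\<close>

abbreviation Ho :: "('o, 'm) cat \<Rightarrow> 'm set \<Rightarrow> ('o, ('o, 'm) zz_arrow) cat" where
  "Ho C W \<equiv> localization C W"

abbreviation Ho_functor ::
    "('o, 'm) cat \<Rightarrow> 'm set \<Rightarrow> ('o, 'm, 'o, ('o, 'm) zz_arrow) func"  (\<open>\<gamma>\<close>) where
  "\<gamma> C W \<equiv> loc_functor C W"

definition comparison :: "'i set \<Rightarrow> ('o, 'm) cat \<Rightarrow> 'm set
    \<Rightarrow> ('i \<Rightarrow> 'o, ('i \<Rightarrow> 'o, 'i \<Rightarrow> 'm) zz_arrow, 'i \<Rightarrow> 'o, 'i \<Rightarrow> ('o, 'm) zz_arrow) func"
    (\<open>\<Theta>\<close>) where
  "\<Theta> I C W = loc_factor (power_cat I C) (power_arrows I W)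
     (power_cat I (Ho C W)) (power_functor I C (\<gamma> C W))"

section \<open>The universal property of the localization\<close>

lemma homI: "f \<in> Arr C \<Longrightarrow> Dom C f = X \<Longrightarrow> Cod C f = Y \<Longrightarrow> f \<in> hom C X Y"
  by (simp add: hom_def)

lemma homD: "f \<in> hom C X Y \<Longrightarrow> f \<in> Arr C \<and> Dom C f = X \<and> Cod C f = Y"
  by (simp add: hom_def)

lemma PiE_restrict_cong: "f \<in> Pi\<^sub>E I F \<Longrightarrow> (\<And>i. i \<in> I \<Longrightarrow> g i = f i) \<Longrightarrow> (\<lambda>i\<in>I. g i) = f"
  by (metis PiE_restrict restrict_ext)

lemma hom_power_iff:
  assumes "X \<in> I \<rightarrow>\<^sub>E Ob C" "Y \<in> I \<rightarrow>\<^sub>E Ob C"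
  shows "f \<in> hom (power_cat I C) X Y \<longleftrightarrow> f \<in> (\<Pi>\<^sub>E i\<in>I. hom C (X i) (Y i))"
proof
  assume f: "f \<in> hom (power_cat I C) X Y"
  then have *: "f \<in> I \<rightarrow>\<^sub>E Arr C" "(\<lambda>i\<in>I. Dom C (f i)) = X" "(\<lambda>i\<in>I. Cod C (f i)) = Y"
    by (auto simp: hom_def power_cat_def)
  then show "f \<in> (\<Pi>\<^sub>E i\<in>I. hom C (X i) (Y i))"
    by (intro PiE_I) (auto simp: hom_def PiE_iff extensional_def)
next
  assume f: "f \<in> (\<Pi>\<^sub>E i\<in>I. hom C (X i) (Y i))"
  then have "f \<in> I \<rightarrow>\<^sub>E Arr C" by (auto simp: PiE_iff hom_def)
  moreover have "(\<lambda>i\<in>I. Dom C (f i)) = X" "(\<lambda>i\<in>I. Cod C (f i)) = Y"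
    using f by (auto intro!: PiE_restrict_cong[OF assms(1)] PiE_restrict_cong[OF assms(2)]
        simp: PiE_iff hom_def)
  ultimately show "f \<in> hom (power_cat I C) X Y" by (simp add: hom_def power_cat_def)
qed

lemma category_power:
  assumes "category C"
  shows "category (power_cat I C)"
proof -
  interpret category C by fact
  let ?P = "power_cat I C"
  have d: "Dom ?P f \<in> Ob ?P" "Cod ?P f \<in> Ob ?P" if "f \<in> Arr ?P" for f
    using that dom_in cod_in by (auto simp: power_cat_def PiE_iff)
  have ob: "X \<in> I \<rightarrow>\<^sub>E Ob C" "Y \<in> I \<rightarrow>\<^sub>E Ob C" if "f \<in> hom ?P X Y" for f X Y
    using d[of f] homD[OF that] by (auto simp: power_cat_def)
  have h: "f \<in> (\<Pi>\<^sub>E i\<in>I. hom C (X i) (Y i))" if "f \<in> hom ?P X Y" for f X Y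
    using that hom_power_iff ob[OF that] by blast
  show ?thesis
  proof
    show "Dom ?P f \<in> Ob ?P" "Cod ?P f \<in> Ob ?P" if "f \<in> Arr ?P" for f
      using d that by auto
    show "Idn ?P X \<in> hom ?P X X" if "X \<in> Ob ?P" for X
    proof -
      have X: "X \<in> I \<rightarrow>\<^sub>E Ob C" using that by (simp add: power_cat_def)
      then show ?thesis
        by (subst hom_power_iff) (auto simp: power_cat_def PiE_iff intro: idn_hom)
    qed
    show "g \<cdot>\<^bsub>?P\<^esub> f \<in> hom ?P X Z" if f: "f \<in> hom ?P X Y" and g: "g \<in> hom ?P Y Z" for f g X Y Z
      using ob[OF f] ob[OF g] h[OF f] h[OF g]
      by (subst hom_power_iff) (auto simp: power_cat_def PiE_iff intro: comp_hom)
    show "f \<cdot>\<^bsub>?P\<^esub> Idn ?P X = f" if f: "f \<in> hom ?P X Y" for f X Y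
      using h[OF f] by (auto simp: power_cat_def PiE_iff intro!: PiE_restrict_cong[OF h[OF f]] idn_right)
    show "Idn ?P Y \<cdot>\<^bsub>?P\<^esub> f = f" if f: "f \<in> hom ?P X Y" for f X Y
      using h[OF f] by (auto simp: power_cat_def PiE_iff intro!: PiE_restrict_cong[OF h[OF f]] idn_left)
    show "(k \<cdot>\<^bsub>?P\<^esub> g) \<cdot>\<^bsub>?P\<^esub> f = k \<cdot>\<^bsub>?P\<^esub> (g \<cdot>\<^bsub>?P\<^esub> f)"
      if f: "f \<in> hom ?P W X" and g: "g \<in> hom ?P X Y" and k: "k \<in> hom ?P Y Z" for f g k W X Y Z
      using h[OF f] h[OF g] h[OF k] by (auto simp: power_cat_def PiE_iff restrict_def intro!: ext assoc)
  qed
qed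

lemma zigzag_ends:
  assumes "category B" "S \<subseteq> Arr B"
  shows "zigzag B S X p Y \<Longrightarrow> X \<in> Ob B \<and> Y \<in> Ob B"
  using assms
  by (induction B S X p Y rule: zigzag.induct) (auto simp: category.dom_in category.cod_in)

lemma zigzag_append:
  "zigzag B S X p Y \<Longrightarrow> zigzag B S Y q Z \<Longrightarrow> zigzag B S X (p @ q) Z"
  by (induction B S X p Y rule: zigzag.induct) auto

lemma zz_eq_zigzag:
  assumes "category B" "S \<subseteq> Arr B"
  shows "zz_eq B S X p q Y \<Longrightarrow> zigzag B S X p Y \<and> zigzag B S X q Y"
proof (induction rule: zz_eq.induct)
  case (zz_idn X)
  then show ?case using category.idn_hom[OF assms(1) zz_idn] by (auto simp: hom_def)
next
  case (zz_comp f X Y g Z)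
  then show ?case
    using category.comp_hom[OF assms(1) zz_comp] category.cod_in[OF assms(1), of g] by (auto simp: hom_def)
next
  case (zz_fwd_bwd s X Y)
  then show ?case using category.dom_in[OF assms(1), of s] by (auto simp: hom_def)
next
  case (zz_bwd_fwd s X Y)
  then show ?case using category.cod_in[OF assms(1), of s] by (auto simp: hom_def)
qed (auto intro: zigzag_append)

lemma zz_class_eq_iff:
  assumes "zigzag B S X p Y"
  shows "zz_class B S X p Y = zz_class B S X q Y \<longleftrightarrow> zz_eq B S X p q Y"
proof
  assume "zz_class B S X p Y = zz_class B S X q Y"
  then have "zz_eq B S X q p Y" using zz_refl[OF assms] by (auto simp: zz_class_def)
  then show "zz_eq B S X p q Y" by (rule zz_sym)
next
  assume "zz_eq B S X p q Y"
  then have "zz_eq B S X p r Y \<longleftrightarrow> zz_eq B S X q r Y" for r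
    by (meson zz_sym zz_trans)
  then show "zz_class B S X p Y = zz_class B S X q Y" by (simp add: zz_class_def)
qed

lemma loc_simps:
  "Ob (localization B S) = Ob B"
  "Arr (localization B S) = {zz_class B S X p Y | X p Y. zigzag B S X p Y}"
  "Dom (localization B S) (zz_class B S X p Y) = X"
  "Cod (localization B S) (zz_class B S X p Y) = Y"
  "Idn (localization B S) X = zz_class B S X [] X"
  by (auto simp: localization_def zz_class_def)

lemma loc_comp:
  assumes "zigzag B S X p Y" "zigzag B S Y q Z"
  shows "zz_class B S Y q Z \<cdot>\<^bsub>localization B S\<^esub> zz_class B S X p Y = zz_class B S X (p @ q) Z"
proof -
  have "(\<exists>p'\<in>{r. zz_eq B S X p r Y}. \<exists>q'\<in>{r. zz_eq B S Y q r Z}. zz_eq B S X (p' @ q') r Z)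
      \<longleftrightarrow> zz_eq B S X (p @ q) r Z" for r
    using assms by (auto intro: zz_trans zz_append zz_refl)
  then show ?thesis by (simp add: localization_def zz_class_def)
qed

lemma loc_hom_iff:
  "a \<in> hom (localization B S) X Y \<longleftrightarrow> (\<exists>p. zigzag B S X p Y \<and> a = zz_class B S X p Y)"
  by (auto simp: hom_def loc_simps)

lemma category_localization:
  assumes "category B" "S \<subseteq> Arr B"
  shows "category (localization B S)"
proof
  note ends = zigzag_ends[OF assms]
  let ?L = "localization B S"
  show "Dom ?L f \<in> Ob ?L" "Cod ?L f \<in> Ob ?L" if "f \<in> Arr ?L" for f
    using that ends by (auto simp: loc_simps)
  show "Idn ?L X \<in> hom ?L X X" if "X \<in> Ob ?L" for X
    using that by (auto simp: loc_simps loc_hom_iff intro!: exI[of _ "[]"])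
  show "g \<cdot>\<^bsub>?L\<^esub> f \<in> hom ?L X Z" if "f \<in> hom ?L X Y" "g \<in> hom ?L Y Z" for f g X Y Z
    using that by (auto simp: loc_hom_iff loc_comp intro: zigzag_append)
  show "f \<cdot>\<^bsub>?L\<^esub> Idn ?L X = f" if "f \<in> hom ?L X Y" for f X Y
    using that ends by (auto simp: loc_hom_iff loc_simps loc_comp)
  show "Idn ?L Y \<cdot>\<^bsub>?L\<^esub> f = f" if "f \<in> hom ?L X Y" for f X Y
    using that ends by (auto simp: loc_hom_iff loc_simps loc_comp)
  show "(h \<cdot>\<^bsub>?L\<^esub> g) \<cdot>\<^bsub>?L\<^esub> f = h \<cdot>\<^bsub>?L\<^esub> (g \<cdot>\<^bsub>?L\<^esub> f)"
    if "f \<in> hom ?L W X" "g \<in> hom ?L X Y" "h \<in> hom ?L Y Z" for f g h W X Y Z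
    using that by (auto simp: loc_hom_iff loc_comp zigzag_append)
qed

lemma zigzag_single:
  assumes "category B" "f \<in> Arr B"
  shows "zigzag B S (Dom B f) [Fwd f] (Cod B f)"
  using assms category.cod_in by auto

lemma loc_functor_functor:
  assumes "category B" "S \<subseteq> Arr B"
  shows "is_functor B (localization B S) (loc_functor B S)"
proof -
  interpret category B by fact
  have "zz_class B S X [Fwd (Idn B X)] X = zz_class B S X [] X" if "X \<in> Ob B" for X
    using that idn_hom[OF that] by (subst zz_class_eq_iff) (auto simp: hom_def intro: zz_idn)
  moreover have "zz_class B S (Dom B f) [Fwd (g \<cdot>\<^bsub>B\<^esub> f)] (Cod B g) =
      zz_class B S (Dom B g) [Fwd g] (Cod B g) \<cdot>\<^bsub>localization B S\<^esub>
      zz_class B S (Dom B f) [Fwd f] (Cod B f)"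
    if "f \<in> Arr B" "g \<in> Arr B" "Cod B f = Dom B g" for f g
  proof -
    have "zz_eq B S (Dom B f) [Fwd f, Fwd g] [Fwd (g \<cdot>\<^bsub>B\<^esub> f)] (Cod B g)"
      using that by (intro zz_comp[of _ _ _ "Cod B f"]) (auto simp: hom_def)
    moreover have "zigzag B S (Dom B f) [Fwd f, Fwd g] (Cod B g)"
      using that cod_in by auto
    ultimately have "zz_class B S (Dom B f) [Fwd f, Fwd g] (Cod B g) =
        zz_class B S (Dom B f) [Fwd (g \<cdot>\<^bsub>B\<^esub> f)] (Cod B g)"
      by (simp add: zz_class_eq_iff)
    then show ?thesis
      using that loc_comp[of B S "Dom B f" "[Fwd f]" "Dom B g" "[Fwd g]" "Cod B g"]
        zigzag_single[OF assms(1), of f S] zigzag_single[OF assms(1), of g S] by simp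
  qed
  moreover have "g \<cdot>\<^bsub>B\<^esub> f \<in> hom B (Dom B f) (Cod B g)"
    if "f \<in> Arr B" "g \<in> Arr B" "Cod B f = Dom B g" for f g
    using that by (intro comp_hom[of _ _ "Cod B f"]) (auto simp: hom_def)
  moreover have "zz_class B S (Dom B f) [Fwd f] (Cod B f) \<in> Arr (localization B S)"
    if "f \<in> Arr B" for f
    using zigzag_single[OF assms(1) that, of S] unfolding loc_simps by blast
  ultimately show ?thesis
    using assms category_localization[OF assms] idn_hom dom_in cod_in
    by (auto simp: is_functor_def loc_functor_def loc_simps hom_def)
qed

lemma loc_step_inverse:
  assumes "category B" "S \<subseteq> Arr B" "s \<in> S"
  shows "zz_class B S (Cod B s) [Bwd s] (Dom B s) \<in> hom (localization B S) (Cod B s) (Dom B s)"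
    and "zz_class B S (Cod B s) [Bwd s] (Dom B s) \<cdot>\<^bsub>localization B S\<^esub> farr (loc_functor B S) s
      = Idn (localization B S) (Dom B s)"
    and "farr (loc_functor B S) s \<cdot>\<^bsub>localization B S\<^esub> zz_class B S (Cod B s) [Bwd s] (Dom B s)
      = Idn (localization B S) (Cod B s)"
proof -
  interpret category B by fact
  have s: "s \<in> Arr B" using assms by auto
  have z: "zigzag B S (Dom B s) [Fwd s] (Cod B s)" "zigzag B S (Cod B s) [Bwd s] (Dom B s)"
    using s assms dom_in cod_in by auto
  then show "zz_class B S (Cod B s) [Bwd s] (Dom B s) \<in> hom (localization B S) (Cod B s) (Dom B s)"
    unfolding loc_hom_iff by blast
  show "zz_class B S (Cod B s) [Bwd s] (Dom B s) \<cdot>\<^bsub>localization B S\<^esub> farr (loc_functor B S) s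
      = Idn (localization B S) (Dom B s)"
    using s z zigzag_append[OF z] assms zz_fwd_bwd[OF assms(3), of B "Dom B s" "Cod B s"]
    by (simp add: loc_functor_def loc_comp loc_simps zz_class_eq_iff hom_def)
  show "farr (loc_functor B S) s \<cdot>\<^bsub>localization B S\<^esub> zz_class B S (Cod B s) [Bwd s] (Dom B s)
      = Idn (localization B S) (Cod B s)"
    using s z zigzag_append[OF z(2,1)] assms zz_bwd_fwd[OF assms(3), of B "Dom B s" "Cod B s"]
    by (simp add: loc_functor_def loc_comp loc_simps zz_class_eq_iff hom_def)
qed

lemma loc_functor_inverts:
  assumes "category B" "S \<subseteq> Arr B" "s \<in> S"
  shows "is_iso (localization B S) (farr (loc_functor B S) s)"
proof -
  have "s \<in> Arr B" using assms by auto
  then have "farr (loc_functor B S) s \<in> hom (localization B S) (Dom B s) (Cod B s)"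
    using zigzag_single[OF assms(1), of s S] unfolding loc_hom_iff
    by (intro exI[of _ "[Fwd s]"]) (simp add: loc_functor_def)
  from homD[OF this] show ?thesis
    unfolding is_iso_def
    by (intro conjI bexI[of _ "zz_class B S (Cod B s) [Bwd s] (Dom B s)"])
      (simp_all add: loc_step_inverse[OF assms])
qed

definition inverse_arr :: "('o, 'm) cat \<Rightarrow> 'm \<Rightarrow> 'm" where
  "inverse_arr C f = (THE g. g \<in> hom C (Cod C f) (Dom C f) \<and>
     g \<cdot>\<^bsub>C\<^esub> f = Idn C (Dom C f) \<and> f \<cdot>\<^bsub>C\<^esub> g = Idn C (Cod C f))"

lemma inverse_unique:
  assumes "category C" "f \<in> hom C X Y" "g \<in> hom C Y X" "h \<in> hom C Y X"
    "g \<cdot>\<^bsub>C\<^esub> f = Idn C X" "f \<cdot>\<^bsub>C\<^esub> h = Idn C Y"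
  shows "g = h"
proof -
  interpret category C by fact
  have "g = g \<cdot>\<^bsub>C\<^esub> (f \<cdot>\<^bsub>C\<^esub> h)" using assms idn_right by simp
  also have "\<dots> = (g \<cdot>\<^bsub>C\<^esub> f) \<cdot>\<^bsub>C\<^esub> h" using assoc[OF assms(4,2,3)] by simp
  also have "\<dots> = h" using assms idn_left by simp
  finally show ?thesis .
qed

lemma inverse_arr:
  assumes "category C" "is_iso C f"
  shows "inverse_arr C f \<in> hom C (Cod C f) (Dom C f)"
    "inverse_arr C f \<cdot>\<^bsub>C\<^esub> f = Idn C (Dom C f)" "f \<cdot>\<^bsub>C\<^esub> inverse_arr C f = Idn C (Cod C f)"
proof -
  have f: "f \<in> hom C (Dom C f) (Cod C f)" using assms by (auto simp: is_iso_def hom_def)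
  have "\<exists>!g. g \<in> hom C (Cod C f) (Dom C f) \<and>
     g \<cdot>\<^bsub>C\<^esub> f = Idn C (Dom C f) \<and> f \<cdot>\<^bsub>C\<^esub> g = Idn C (Cod C f)"
    using assms(2) inverse_unique[OF assms(1) f] unfolding is_iso_def by blast
  from theI'[OF this]
  show "inverse_arr C f \<in> hom C (Cod C f) (Dom C f)"
    "inverse_arr C f \<cdot>\<^bsub>C\<^esub> f = Idn C (Dom C f)" "f \<cdot>\<^bsub>C\<^esub> inverse_arr C f = Idn C (Cod C f)"
    unfolding inverse_arr_def by blast+
qed

fun zz_eval :: "('o, 'm) cat \<Rightarrow> ('p, 'n) cat \<Rightarrow> ('o, 'm, 'p, 'n) func \<Rightarrow> 'o \<Rightarrow> 'm step list \<Rightarrow> 'n" where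
  "zz_eval B D F X [] = Idn D (fobj F X)"
| "zz_eval B D F X (Fwd f # p) = zz_eval B D F (Cod B f) p \<cdot>\<^bsub>D\<^esub> farr F f"
| "zz_eval B D F X (Bwd s # p) = zz_eval B D F (Dom B s) p \<cdot>\<^bsub>D\<^esub> inverse_arr D (farr F s)"

lemma functor_hom: "is_functor C D F \<Longrightarrow> f \<in> hom C X Y \<Longrightarrow> farr F f \<in> hom D (fobj F X) (fobj F Y)"
  by (auto simp: is_functor_def hom_def)

lemma functor_ob: "is_functor C D F \<Longrightarrow> X \<in> Ob C \<Longrightarrow> fobj F X \<in> Ob D"
  by (auto simp: is_functor_def)

lemma functor_comp: "is_functor C D F \<Longrightarrow> f \<in> hom C X Y \<Longrightarrow> g \<in> hom C Y Z \<Longrightarrow>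
    farr F (g \<cdot>\<^bsub>C\<^esub> f) = farr F g \<cdot>\<^bsub>D\<^esub> farr F f"
  by (auto simp: is_functor_def hom_def)

lemma functor_idn: "is_functor C D F \<Longrightarrow> X \<in> Ob C \<Longrightarrow> farr F (Idn C X) = Idn D (fobj F X)"
  by (auto simp: is_functor_def)

lemma functor_arb: "is_functor C D F \<Longrightarrow> f \<notin> Arr C \<Longrightarrow> farr F f = undefined"
  by (auto simp only: is_functor_def intro: PiE_arb)

locale inverting_functor =
  fixes B :: "('o, 'm) cat" and S :: "'m set" and D :: "('p, 'n) cat" and F :: "('o, 'm, 'p, 'n) func"
  assumes S_Arr: "S \<subseteq> Arr B"
    and F_functor: "is_functor B D F"
    and F_inverts: "s \<in> S \<Longrightarrow> is_iso D (farr F s)"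
begin

lemma B_cat: "category B" and D_cat: "category D"
  using F_functor by (auto simp: is_functor_def)

interpretation B: category B by (rule B_cat)
interpretation D: category D by (rule D_cat)

lemma F_inverse:
  assumes "s \<in> S" "s \<in> hom B X Y"
  shows "inverse_arr D (farr F s) \<in> hom D (fobj F Y) (fobj F X)"
    "inverse_arr D (farr F s) \<cdot>\<^bsub>D\<^esub> farr F s = Idn D (fobj F X)"
    "farr F s \<cdot>\<^bsub>D\<^esub> inverse_arr D (farr F s) = Idn D (fobj F Y)"
  using inverse_arr[OF D_cat F_inverts[OF assms(1)]] functor_hom[OF F_functor assms(2)]
  by (auto simp: hom_def)

lemma S_hom: "s \<in> S \<Longrightarrow> s \<in> hom B (Dom B s) (Cod B s)"
  using S_Arr by (auto simp: hom_def)

lemma eval_hom: "zigzag B S X p Y \<Longrightarrow> zz_eval B D F X p \<in> hom D (fobj F X) (fobj F Y)"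
proof (induction p arbitrary: X)
  case Nil
  then have "Y = X" "fobj F X \<in> Ob D" using functor_ob[OF F_functor, of X] by auto
  then show ?case by (simp add: D.idn_hom)
next
  case (Cons a p)
  show ?case
  proof (cases a)
    case (Fwd f)
    have "farr F f \<in> hom D (fobj F X) (fobj F (Cod B f))"
      using Cons.prems Fwd by (intro functor_hom[OF F_functor]) (auto simp: hom_def)
    then show ?thesis using Cons Fwd by (auto intro: D.comp_hom)
  next
    case (Bwd s)
    then show ?thesis using Cons F_inverse(1)[OF _ S_hom, of s] by (auto intro: D.comp_hom)
  qed
qed

lemma eval_append:
  "zigzag B S X p Y \<Longrightarrow> zigzag B S Y q Z \<Longrightarrow>
    zz_eval B D F X (p @ q) = zz_eval B D F Y q \<cdot>\<^bsub>D\<^esub> zz_eval B D F X p"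
proof (induction p arbitrary: X)
  case Nil
  then show ?case using D.idn_right[OF eval_hom[of Y q Z]] by simp
next
  case (Cons a p)
  show ?case
  proof (cases a)
    case (Fwd f)
    have "farr F f \<in> hom D (fobj F X) (fobj F (Cod B f))"
      using Cons.prems Fwd by (intro functor_hom[OF F_functor]) (auto simp: hom_def)
    then show ?thesis
      using Cons Fwd D.assoc[OF _ eval_hom eval_hom, of "farr F f" "fobj F X" "Cod B f" p Y q Z] by auto
  next
    case (Bwd s)
    then show ?thesis
      using Cons F_inverse(1)[OF _ S_hom, of s]
        D.assoc[OF _ eval_hom eval_hom, of "inverse_arr D (farr F s)" "fobj F X" "Dom B s" p Y q Z] by auto
  qed
qed

lemma eval_cong: "zz_eq B S X p q Y \<Longrightarrow> zz_eval B D F X p = zz_eval B D F X q"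
proof (induction rule: zz_eq.induct)
  case (zz_append X p p' Y q q' Z)
  have z: "zigzag B S X p Y" "zigzag B S X p' Y" "zigzag B S Y q Z" "zigzag B S Y q' Z"
    using zz_eq_zigzag[OF B_cat S_Arr zz_append.hyps(1)] zz_eq_zigzag[OF B_cat S_Arr zz_append.hyps(2)]
    by auto
  show ?case
    using zz_append.IH eval_append[OF z(1,3)] eval_append[OF z(2,4)] by simp
next
  case (zz_idn X)
  have *: "Cod B (Idn B X) = X" using B.idn_hom[OF zz_idn] by (auto simp: hom_def)
  have "fobj F X \<in> Ob D" using functor_ob[OF F_functor zz_idn] .
  then show ?case using * zz_idn D.idn_left[OF D.idn_hom] by (simp add: functor_idn[OF F_functor])
next
  case (zz_comp f X Y g Z)
  have gf: "g \<cdot>\<^bsub>B\<^esub> f \<in> hom B X Z" using B.comp_hom zz_comp by blast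
  note c = homD[OF gf] homD[OF zz_comp(1)] homD[OF zz_comp(2)]
  note h = functor_hom[OF F_functor zz_comp(1)] functor_hom[OF F_functor zz_comp(2)]
  show ?case
    using c functor_comp[OF F_functor zz_comp] D.idn_left[OF h(1)] D.idn_left[OF h(2)]
      D.idn_left[OF D.comp_hom[OF h]] by simp
next
  case (zz_fwd_bwd s X Y)
  note c = homD[OF zz_fwd_bwd(2)]
  show ?case
    using c F_inverse[OF zz_fwd_bwd] D.idn_left[of "inverse_arr D (farr F s)" "fobj F Y" "fobj F X"] by simp
next
  case (zz_bwd_fwd s X Y)
  note c = homD[OF zz_bwd_fwd(2)]
  show ?case
    using c F_inverse[OF zz_bwd_fwd] D.idn_left[OF functor_hom[OF F_functor zz_bwd_fwd(2)]] by simp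
qed auto

definition factor :: "('o, ('o, 'm) zz_arrow, 'p, 'n) func" where
  "factor = \<lparr>fobj = fobj F,
     farr = \<lambda>a \<in> Arr (localization B S). zz_eval B D F (fst a) (SOME p. p \<in> fst (snd a))\<rparr>"

lemma factor_class:
  assumes "zigzag B S X p Y"
  shows "farr factor (zz_class B S X p Y) = zz_eval B D F X p"
proof -
  have "zz_eq B S X p (SOME q. zz_eq B S X p q Y) Y"
    using zz_refl[OF assms] by (rule someI)
  then have "zz_eval B D F X (SOME q. zz_eq B S X p q Y) = zz_eval B D F X p"
    using eval_cong by metis
  moreover have "zz_class B S X p Y \<in> Arr (localization B S)"
    using assms by (auto simp: loc_simps)
  ultimately show ?thesis by (simp add: factor_def zz_class_def)
qed

lemma factor_functor: "is_functor (localization B S) D factor"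
  unfolding is_functor_def
proof (intro conjI ballI impI)
  let ?L = "localization B S"
  have fo: "fobj factor = fobj F" by (simp add: factor_def)
  have h: "farr factor a \<in> hom D (fobj F (Dom ?L a)) (fobj F (Cod ?L a))" if "a \<in> Arr ?L" for a
    using that by (auto simp: loc_simps factor_class eval_hom)
  show "category ?L" by (rule category_localization[OF B_cat S_Arr])
  show "category D" by (rule D_cat)
  show "fobj factor \<in> Ob ?L \<rightarrow>\<^sub>E Ob D"
    using F_functor by (simp add: fo loc_simps is_functor_def)
  show "farr factor \<in> Arr ?L \<rightarrow>\<^sub>E Arr D"
    using h by (intro PiE_I) (auto simp: hom_def factor_def)
  show "Dom D (farr factor a) = fobj factor (Dom ?L a)" "Cod D (farr factor a) = fobj factor (Cod ?L a)"
    if "a \<in> Arr ?L" for a using h[OF that] by (auto simp: hom_def fo)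
  show "farr factor (Idn ?L X) = Idn D (fobj factor X)" if "X \<in> Ob ?L" for X
    using that by (simp add: loc_simps factor_class fo)
  show "farr factor (g \<cdot>\<^bsub>?L\<^esub> f) = farr factor g \<cdot>\<^bsub>D\<^esub> farr factor f"
    if "f \<in> Arr ?L" "g \<in> Arr ?L" "Cod ?L f = Dom ?L g" for f g
    using that by (auto simp: loc_simps loc_comp factor_class zigzag_append eval_append)
qed

lemma factor_comp: "comp_functor B factor (loc_functor B S) = F"
proof -
  have "fobj F \<in> extensional (Ob B)" "farr F \<in> extensional (Arr B)"
    using F_functor by (auto simp: is_functor_def PiE_iff)
  moreover have "farr factor (zz_class B S (Dom B f) [Fwd f] (Cod B f)) = farr F f"
    if "f \<in> Arr B" for f
    using factor_class[OF zigzag_single[OF B_cat that]] that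
      D.idn_left[OF functor_hom[OF F_functor homI[OF that refl refl]]] by simp
  moreover have "fobj factor = fobj F" by (simp add: factor_def)
  ultimately have "fobj (comp_functor B factor (loc_functor B S)) = fobj F"
    "farr (comp_functor B factor (loc_functor B S)) = farr F"
    by (auto simp: comp_functor_def compose_def loc_functor_def extensional_def fun_eq_iff)
  then show ?thesis by simp
qed

lemma factor_unique:
  assumes G: "is_functor (localization B S) D G"
    and GF: "comp_functor B G (loc_functor B S) = F"
  shows "G = factor"
proof -
  let ?L = "localization B S"
  have o: "fobj G X = fobj F X" if "X \<in> Ob B" for X
    using that by (simp add: GF[symmetric] comp_functor_def compose_def loc_functor_def)
  have a: "farr G (farr (loc_functor B S) f) = farr F f" if "f \<in> Arr B" for f
    using that by (simp add: GF[symmetric] comp_functor_def compose_def)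
  have g: "farr (loc_functor B S) f = zz_class B S (Dom B f) [Fwd f] (Cod B f)" if "f \<in> Arr B" for f
    using that by (simp add: loc_functor_def)
  have b: "farr G (zz_class B S (Cod B s) [Bwd s] (Dom B s)) = inverse_arr D (farr F s)" if s: "s \<in> S" for s
  proof (rule inverse_unique[OF D_cat])
    let ?b = "zz_class B S (Cod B s) [Bwd s] (Dom B s)" and ?f = "farr (loc_functor B S) s"
    note sh = S_hom[OF s]
    note st = loc_step_inverse[OF B_cat S_Arr s]
    have sA: "s \<in> Arr B" and ob: "Dom B s \<in> Ob B" "Cod B s \<in> Ob B"
      using s S_Arr B.dom_in B.cod_in by auto
    have fh: "?f \<in> hom ?L (Dom B s) (Cod B s)"
      using zigzag_single[OF B_cat sA, of S] g[OF sA] unfolding loc_hom_iff by blast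
    show "farr F s \<in> hom D (fobj F (Dom B s)) (fobj F (Cod B s))"
      using functor_hom[OF F_functor sh] .
    show "farr G ?b \<in> hom D (fobj F (Cod B s)) (fobj F (Dom B s))"
      using functor_hom[OF G st(1)] o ob by simp
    show "inverse_arr D (farr F s) \<in> hom D (fobj F (Cod B s)) (fobj F (Dom B s))"
      "farr F s \<cdot>\<^bsub>D\<^esub> inverse_arr D (farr F s) = Idn D (fobj F (Cod B s))"
      using F_inverse[OF s sh] by auto
    show "farr G ?b \<cdot>\<^bsub>D\<^esub> farr F s = Idn D (fobj F (Dom B s))"
      using functor_comp[OF G fh st(1)] st(2) a[OF sA] functor_idn[OF G, of "Dom B s"] o ob
      by (simp add: loc_simps)
  qed
  have e: "farr G (zz_class B S X p Y) = zz_eval B D F X p" if "zigzag B S X p Y" for X p Y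
    using that
  proof (induction p arbitrary: X)
    case Nil
    then have "Y = X" "X \<in> Ob B" by auto
    then show ?case using functor_idn[OF G, of X] o[of X] by (simp add: loc_simps)
  next
    case (Cons c p)
    have split: "farr G (zz_class B S X (c # p) Y) = zz_eval B D F Z p \<cdot>\<^bsub>D\<^esub> farr G (zz_class B S X [c] Z)"
      if "zigzag B S X [c] Z" "zigzag B S Z p Y" for Z
      using loc_comp[OF that] functor_comp[OF G, of "zz_class B S X [c] Z" X Z "zz_class B S Z p Y" Y]
        Cons.IH[OF that(2)] that by (auto simp: loc_hom_iff)
    show ?case
    proof (cases c)
      case (Fwd f)
      then show ?thesis
        using Cons.prems split[of "Cod B f"] a[of f] g[of f] zigzag_single[OF B_cat, of f S] B.cod_in by auto
    next
      case (Bwd s)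
      then show ?thesis
        using Cons.prems split[of "Dom B s"] b[of s] S_Arr B.dom_in by auto
    qed
  qed
  have "farr G a = farr factor a" for a
  proof (cases "a \<in> Arr ?L")
    case True
    then show ?thesis using e factor_class by (auto simp: loc_simps)
  next
    case False
    then show ?thesis using functor_arb[OF G] functor_arb[OF factor_functor] by simp
  qed
  moreover have "fobj G X = fobj factor X" for X
    using o[of X] G F_functor by (cases "X \<in> Ob B")
      (auto simp: is_functor_def PiE_iff extensional_def factor_def loc_simps)
  ultimately show ?thesis by (simp add: fun_eq_iff func.equality)
qed

end

theorem localization_universal:
  assumes "S \<subseteq> Arr B" "is_functor B D F" "\<forall>s\<in>S. is_iso D (farr F s)"
  shows "\<exists>!G. is_functor (localization B S) D G \<and> comp_functor B G (loc_functor B S) = F"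
proof -
  interpret inverting_functor B S D F by unfold_locales (use assms in auto)
  show ?thesis using factor_functor factor_comp factor_unique by blast
qed

text \<open>Hence \<open>\<gamma>\<^sup>I\<close> factors uniquely through the localization of the power, and the description
  operator in \<open>\<Theta>\<close> denotes this factorization.\<close>

lemma power_functor_functor:
  assumes F: "is_functor C D F"
  shows "is_functor (power_cat I C) (power_cat I D) (power_functor I C F)"
  unfolding is_functor_def
proof (intro conjI ballI impI)
  let ?P = "power_cat I C" and ?Q = "power_cat I D" and ?G = "power_functor I C F"
  have C: "category C" and D: "category D" using F by (auto simp: is_functor_def)
  show cP: "category ?P" and "category ?Q" using C D category_power by blast+
  have oF: "fobj F X \<in> Ob D" if "X \<in> Ob C" for X using functor_ob[OF F that] .
  have aF: "farr F f \<in> Arr D" "Dom D (farr F f) = fobj F (Dom C f)" "Cod D (farr F f) = fobj F (Cod C f)"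
    if "f \<in> Arr C" for f using F that by (auto simp: is_functor_def)
  show "fobj ?G \<in> Ob ?P \<rightarrow>\<^sub>E Ob ?Q" "farr ?G \<in> Arr ?P \<rightarrow>\<^sub>E Arr ?Q"
    using oF aF by (auto simp: power_functor_def power_cat_def PiE_iff)
  show "Dom ?Q (farr ?G f) = fobj ?G (Dom ?P f)" "Cod ?Q (farr ?G f) = fobj ?G (Cod ?P f)"
    if "f \<in> Arr ?P" for f
    using that aF category.dom_in[OF C] category.cod_in[OF C]
    by (auto simp: power_functor_def power_cat_def PiE_iff intro!: restrict_ext)
  show "farr ?G (Idn ?P X) = Idn ?Q (fobj ?G X)" if "X \<in> Ob ?P" for X
    using that functor_idn[OF F] homD[OF category.idn_hom[OF C]]
    by (auto simp: power_functor_def power_cat_def PiE_iff intro!: restrict_ext)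
  show "farr ?G (g \<cdot>\<^bsub>?P\<^esub> f) = farr ?G g \<cdot>\<^bsub>?Q\<^esub> farr ?G f"
    if f: "f \<in> Arr ?P" and g: "g \<in> Arr ?P" and fg: "Cod ?P f = Dom ?P g" for f g
  proof -
    have i: "f i \<in> hom C (Dom C (f i)) (Cod C (f i))" "g i \<in> hom C (Cod C (f i)) (Cod C (g i))"
      if "i \<in> I" for i
      using that f g fun_cong[OF fg, of i] by (auto simp: power_cat_def hom_def)
    have "g \<cdot>\<^bsub>?P\<^esub> f \<in> Arr ?P"
      using homD[OF category.comp_hom[OF C i]] by (auto simp: power_cat_def)
    then show ?thesis
      using f g functor_comp[OF F i]
      by (auto simp: power_functor_def power_cat_def intro!: restrict_ext)
  qed
qed

lemma is_iso_power:
  assumes C: "category C" and f: "f \<in> I \<rightarrow>\<^sub>E Arr C" and iso: "\<And>i. i \<in> I \<Longrightarrow> is_iso C (f i)"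
  shows "is_iso (power_cat I C) f"
proof -
  let ?P = "power_cat I C" and ?g = "\<lambda>i\<in>I. inverse_arr C (f i)"
  note inv = inverse_arr[OF C iso]
  have "?g \<in> hom ?P (Cod ?P f) (Dom ?P f)"
    using homD[OF inv(1)] by (auto simp: hom_def power_cat_def intro!: restrict_ext)
  moreover have "?g \<cdot>\<^bsub>?P\<^esub> f = Idn ?P (Dom ?P f)" "f \<cdot>\<^bsub>?P\<^esub> ?g = Idn ?P (Cod ?P f)"
    using inv by (auto simp: power_cat_def intro!: restrict_ext)
  moreover have "f \<in> Arr ?P" using f by (simp add: power_cat_def)
  ultimately show ?thesis unfolding is_iso_def by blast
qed

theorem comparison_factorization:
  assumes "category C" "W \<subseteq> Arr C"
  shows "\<exists>!G. is_functor (Ho (power_cat I C) (power_arrows I W)) (power_cat I (Ho C W)) G \<and>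
    comp_functor (power_cat I C) G (\<gamma> (power_cat I C) (power_arrows I W)) = power_functor I C (\<gamma> C W)"
proof (rule localization_universal)
  note g = loc_functor_functor[OF assms]
  show "power_arrows I W \<subseteq> Arr (power_cat I C)"
    using assms by (auto simp: power_arrows_def power_cat_def PiE_iff)
  show "is_functor (power_cat I C) (power_cat I (Ho C W)) (power_functor I C (\<gamma> C W))"
    by (rule power_functor_functor[OF g])
  show "\<forall>w\<in>power_arrows I W. is_iso (power_cat I (Ho C W)) (farr (power_functor I C (\<gamma> C W)) w)"
  proof
    fix w assume "w \<in> power_arrows I W"
    then have w: "w \<in> I \<rightarrow>\<^sub>E Arr C" "\<And>i. i \<in> I \<Longrightarrow> w i \<in> W"
      using assms by (auto simp: power_arrows_def PiE_iff)
    then have e: "farr (power_functor I C (\<gamma> C W)) w = (\<lambda>i\<in>I. farr (\<gamma> C W) (w i))"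
      by (simp add: power_functor_def power_cat_def)
    have "is_iso (Ho C W) (farr (\<gamma> C W) (w i))" if "i \<in> I" for i
      using loc_functor_inverts[OF assms w(2)[OF that]] .
    then show "is_iso (power_cat I (Ho C W)) (farr (power_functor I C (\<gamma> C W)) w)"
      unfolding e by (intro is_iso_power category_localization[OF assms]) (auto simp: is_iso_def)
  qed
qed

end

theory Submission
  imports Defs
begin

text \<open>An arrow of a localization is a zigzag of arbitrary length, and two zigzags are identified by
  a chain of arbitrarily many elementary moves. A family of zigzags, or of chains of moves, indexed
  by an infinite set need not have bounded length, and only a bounded family is a single zigzag, or a
  single chain, in the power. So the comparison functor has no reason to be full or faithful for a
  general class of inverted arrows. For weak equivalences both lengths are bounded by a constant.

  For fullness: if \<open>X\<close> is cofibrant and \<open>j : Y \<rightarrow> Y'\<close> is a fibrant replacement, every arrow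
  \<open>a : X \<rightarrow> Y\<close> of the homotopy category satisfies \<open>\<gamma> j \<cdot> a = \<gamma> f\<close> for one arrow \<open>f : X \<rightarrow> Y'\<close>
  (\<open>loc_arrow_representable\<close>). Replacing sources by cofibrant objects and targets by fibrant ones,
  a family of arrows of the homotopy category is represented by a family of arrows \<open>f i\<close>, which is
  an arrow of the power (\<open>Theta_full\<close>).

  For faithfulness: if \<open>\<gamma> f = \<gamma> g\<close> for \<open>f, g : X \<rightarrow> Y\<close> with \<open>X\<close> cofibrant, then \<open>f\<close> and \<open>g\<close> become
  left homotopic after composition with a fibrant replacement of \<open>Y\<close> (\<open>loc_eq_imp_homotopic\<close>). A
  left homotopy is a diagram of fixed shape, a family of them is a left homotopy in the power, and a
  left homotopy forces equality in the homotopy category (\<open>homotopic_imp_loc_eq\<close>). The power is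
  itself a model structure, so two of its homotopy arrows can first be represented by arrows \<open>f\<close> and
  \<open>g\<close> of the power with the same replacements (\<open>Theta_faithful\<close>).

  The theorem on left homotopies rests on the functor sending \<open>Y\<close> to the homotopy classes of arrows
  from \<open>X\<close> to a fibrant replacement of \<open>Y\<close>: it inverts the weak equivalences, hence factors through
  the homotopy category. That homotopy is an equivalence relation is usually proved by gluing
  cylinders along a pushout. Here homotopies are transferred between cylinders and path objects by
  lifting, which takes only binary products and coproducts.\<close>

section \<open>Composition, isomorphisms and binary products\<close>

context category
begin

lemma comp_arr:
  assumes "f \<in> Arr C" "g \<in> Arr C" "Cod C f = Dom C g"
  shows "g \<cdot> f \<in> Arr C" "Dom C (g \<cdot> f) = Dom C f" "Cod C (g \<cdot> f) = Cod C g"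
  using comp_hom[of f "Dom C f" "Cod C f" g "Cod C g"] assms by (auto simp: hom_def)

lemma comp_assoc:
  assumes "f \<in> Arr C" "g \<in> Arr C" "h \<in> Arr C" "Cod C f = Dom C g" "Cod C g = Dom C h"
  shows "(h \<cdot> g) \<cdot> f = h \<cdot> (g \<cdot> f)"
  using assoc[of f "Dom C f" "Cod C f" g "Cod C g" h "Cod C h"] assms by (auto simp: hom_def)

lemma idn_arr:
  assumes "X \<in> Ob C"
  shows "Idn C X \<in> Arr C" "Dom C (Idn C X) = X" "Cod C (Idn C X) = X"
  using idn_hom[OF assms] by (auto simp: hom_def)

lemma comp_idn:
  assumes "f \<in> Arr C"
  shows "Dom C f = X \<Longrightarrow> f \<cdot> Idn C X = f" "Cod C f = Y \<Longrightarrow> Idn C Y \<cdot> f = f"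
  using assms idn_left idn_right by (auto simp: hom_def)

lemmas cat_simps = hom_def comp_arr comp_assoc idn_arr comp_idn dom_in cod_in

text \<open>The right-associated form in which an equation between composites is applied inside a longer
  composite.\<close>

lemma reassoc:
  assumes "g \<cdot> f = h" "f \<in> hom C X Y" "g \<in> hom C Y Z" "e \<in> Arr C" "Cod C e = X"
  shows "g \<cdot> (f \<cdot> e) = h \<cdot> e"
  using assms comp_assoc[of e f g] by (simp add: hom_def)

lemma iso_cancel_left:
  assumes "is_iso C s" "s \<in> hom C Y Z" "a \<in> hom C X Y" "b \<in> hom C X Y" "s \<cdot> a = s \<cdot> b"
  shows "a = b"
proof -
  obtain t where t: "t \<in> hom C Z Y" "t \<cdot> s = Idn C Y"
    using assms(1,2) by (auto simp: is_iso_def hom_def)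
  have "a = (t \<cdot> s) \<cdot> a" using t assms(3) idn_left by simp
  also have "\<dots> = (t \<cdot> s) \<cdot> b" using assms(5) assoc[OF assms(3,2) t(1)] assoc[OF assms(4,2) t(1)] by simp
  also have "\<dots> = b" using t assms(4) idn_left by simp
  finally show ?thesis .
qed

lemma iso_cancel_right:
  assumes "is_iso C s" "s \<in> hom C W X" "a \<in> hom C X Y" "b \<in> hom C X Y" "a \<cdot> s = b \<cdot> s"
  shows "a = b"
proof -
  obtain t where t: "t \<in> hom C X W" "s \<cdot> t = Idn C X"
    using assms(1,2) by (auto simp: is_iso_def hom_def)
  have "a = a \<cdot> (s \<cdot> t)" using t assms(3) idn_right by simp
  also have "\<dots> = b \<cdot> (s \<cdot> t)" using assms(5) assoc[OF t(1) assms(2,3)] assoc[OF t(1) assms(2,4)] by simp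
  also have "\<dots> = b" using t assms(4) idn_right by simp
  finally show ?thesis .
qed

lemma iso_divide:
  assumes "is_iso C s" "s \<in> hom C X' X" "is_iso C t" "t \<in> hom C Y Y'" "b \<in> hom C X' Y'"
  obtains a where "a \<in> hom C X Y" "t \<cdot> (a \<cdot> s) = b"
proof -
  obtain s' where s': "s' \<in> hom C X X'" "s' \<cdot> s = Idn C X'"
    using assms(1,2) by (auto simp: is_iso_def hom_def)
  obtain t' where t': "t' \<in> hom C Y' Y" "t \<cdot> t' = Idn C Y'"
    using assms(3,4) by (auto simp: is_iso_def hom_def)
  have bs: "b \<cdot> s' \<in> hom C X Y'" using assms(5) s' comp_hom by blast
  have "t \<cdot> ((t' \<cdot> (b \<cdot> s')) \<cdot> s) = t \<cdot> (t' \<cdot> b)"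
    using assoc[OF assms(2) bs t'(1)] assoc[OF assms(2) s'(1) assms(5)] s'(2) idn_right[OF assms(5)] by simp
  also have "\<dots> = b"
    using assoc[OF assms(5) t'(1) assms(4)] t'(2) idn_left[OF assms(5)] by simp
  finally show thesis
    using assms s' t' by (intro that[of "t' \<cdot> (b \<cdot> s')"]) (auto intro: comp_hom)
qed

lemma binary_coproduct:
  assumes "has_finite_coproducts C" "X \<in> Ob C"
  obtains Z d e where "d \<in> hom C X Z" "e \<in> hom C X Z"
    "\<And>T a b. a \<in> hom C X T \<Longrightarrow> b \<in> hom C X T \<Longrightarrow> \<exists>!u. u \<in> hom C Z T \<and> u \<cdot> d = a \<and> u \<cdot> e = b"
proof -
  obtain Z \<iota> where Z: "is_coproduct C {..<2::nat} (\<lambda>_. X) Z \<iota>"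
    using assms(1)[unfolded has_finite_coproducts_def, rule_format, of "\<lambda>_. X" 2] assms(2) by auto
  have "\<exists>!u. u \<in> hom C Z T \<and> u \<cdot> \<iota> 0 = a \<and> u \<cdot> \<iota> 1 = b" if ab: "a \<in> hom C X T" "b \<in> hom C X T" for T a b
  proof -
    have T: "T \<in> Ob C" using ab cod_in by (auto simp: hom_def)
    have all: "(\<forall>j\<in>{..<2::nat}. Q j) \<longleftrightarrow> Q 0 \<and> Q 1" for Q by (auto simp: less_2_cases_iff)
    have "\<And>t. (\<forall>j\<in>{..<2::nat}. t j \<in> hom C X T) \<longrightarrow> (\<exists>!u. u \<in> hom C Z T \<and> (\<forall>j\<in>{..<2::nat}. u \<cdot> \<iota> j = t j))"
      using Z T unfolding is_coproduct_def by blast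
    from this[of "\<lambda>j. if j = 0 then a else b"] show ?thesis using ab unfolding all by simp
  qed
  moreover have "\<iota> 0 \<in> hom C X Z" "\<iota> 1 \<in> hom C X Z" using Z by (auto simp: is_coproduct_def)
  ultimately show thesis using that by blast
qed

lemma binary_product:
  assumes "has_finite_products C" "Y \<in> Ob C"
  obtains Z d e where "d \<in> hom C Z Y" "e \<in> hom C Z Y"
    "\<And>T a b. a \<in> hom C T Y \<Longrightarrow> b \<in> hom C T Y \<Longrightarrow> \<exists>!u. u \<in> hom C T Z \<and> d \<cdot> u = a \<and> e \<cdot> u = b"
proof -
  obtain Z \<pi> where Z: "is_product C {..<2::nat} (\<lambda>_. Y) Z \<pi>"
    using assms(1)[unfolded has_finite_products_def, rule_format, of "\<lambda>_. Y" 2] assms(2) by auto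
  have "\<exists>!u. u \<in> hom C T Z \<and> \<pi> 0 \<cdot> u = a \<and> \<pi> 1 \<cdot> u = b" if ab: "a \<in> hom C T Y" "b \<in> hom C T Y" for T a b
  proof -
    have T: "T \<in> Ob C" using ab dom_in by (auto simp: hom_def)
    have all: "(\<forall>j\<in>{..<2::nat}. Q j) \<longleftrightarrow> Q 0 \<and> Q 1" for Q by (auto simp: less_2_cases_iff)
    have "\<And>t. (\<forall>j\<in>{..<2::nat}. t j \<in> hom C T Y) \<longrightarrow> (\<exists>!u. u \<in> hom C T Z \<and> (\<forall>j\<in>{..<2::nat}. \<pi> j \<cdot> u = t j))"
      using Z T unfolding is_product_def by blast
    from this[of "\<lambda>j. if j = 0 then a else b"] show ?thesis using ab unfolding all by simp
  qed
  moreover have "\<pi> 0 \<in> hom C Z Y" "\<pi> 1 \<in> hom C Z Y" using Z by (auto simp: is_product_def)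
  ultimately show thesis using that by blast
qed

end

section \<open>Induction over the arrows of a localization\<close>

text \<open>Induction on the length of a zigzag, with its last step removed. A backward step along \<open>s\<close>
  is expressed by the equation that it solves, so that no inverse has to be named.\<close>

lemma loc_hom_induct [consumes 3, case_names idn comp divide]:
  assumes B: "category B" "S \<subseteq> Arr B"
    and a: "a \<in> hom (localization B S) X Y"
    and idn: "X \<in> Ob B \<Longrightarrow> P X (Idn (localization B S) X)"
    and comp: "\<And>a g Y Z. a \<in> hom (localization B S) X Y \<Longrightarrow> g \<in> hom B Y Z \<Longrightarrow> P Y a \<Longrightarrow>
      P Z (farr (loc_functor B S) g \<cdot>\<^bsub>localization B S\<^esub> a)"
    and divide: "\<And>a b s Y Z. a \<in> hom (localization B S) X Y \<Longrightarrow> b \<in> hom (localization B S) X Z \<Longrightarrow>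
      s \<in> S \<Longrightarrow> s \<in> hom B Z Y \<Longrightarrow> farr (loc_functor B S) s \<cdot>\<^bsub>localization B S\<^esub> b = a \<Longrightarrow>
      P Y a \<Longrightarrow> P Z b"
  shows "P Y a"
proof -
  let ?L = "localization B S"
  interpret L: category ?L by (rule category_localization[OF B])
  note G = loc_functor_functor[OF B]
  obtain p where p: "zigzag B S X p Y" "a = zz_class B S X p Y"
    using a by (auto simp: loc_hom_iff)
  have split: "\<exists>Z. zigzag B S X p Z \<and> zigzag B S Z q Y" if "zigzag B S X (p @ q) Y" for X p q Y
    using that
  proof (induction p arbitrary: X)
    case Nil
    then show ?case using zigzag_ends[OF B, of X q Y] by auto
  next
    case (Cons c p)
    then show ?case by (cases c) auto
  qed
  have "P Y (zz_class B S X p Y)" using p(1)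
  proof (induction p arbitrary: Y rule: rev_induct)
    case Nil
    then have "Y = X" "X \<in> Ob B" by auto
    then show ?case using idn by (simp add: loc_simps)
  next
    case (snoc c p)
    obtain Z where Z: "zigzag B S X p Z" "zigzag B S Z [c] Y" using split[OF snoc.prems] by blast
    have h: "zz_class B S X p Z \<in> hom ?L X Z" using Z(1) by (auto simp: loc_hom_iff)
    have hc: "zz_class B S Z [c] Y \<in> hom ?L Z Y"
      using Z(2) by (auto simp: loc_hom_iff simp del: zigzag.simps)
    have hpc: "zz_class B S X (p @ [c]) Y \<in> hom ?L X Y"
      using snoc.prems by (auto simp: loc_hom_iff simp del: zigzag.simps)
    note IH = snoc.IH[OF Z(1)]
    show ?case
    proof (cases c)
      case (Fwd g)
      then have g: "g \<in> hom B Z Y" using Z by (auto simp: hom_def)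
      then have "farr (loc_functor B S) g = zz_class B S Z [c] Y"
        using Fwd by (auto simp: loc_functor_def hom_def)
      then show ?thesis using comp[OF h g IH] loc_comp[OF Z] by simp
    next
      case (Bwd s)
      then have s: "s \<in> S" "s \<in> hom B Y Z" using Z B by (auto simp: hom_def)
      note st = loc_step_inverse[OF B s(1)]
      have sh: "farr (loc_functor B S) s \<in> hom ?L Y Z"
        using functor_hom[OF G s(2)] s(2) B category.dom_in[OF B(1)] category.cod_in[OF B(1)]
        by (auto simp: loc_functor_def hom_def)
      have "farr (loc_functor B S) s \<cdot>\<^bsub>?L\<^esub> zz_class B S X (p @ [c]) Y = zz_class B S X p Z"
        using st(3) s(2) Bwd L.assoc[OF h hc sh] loc_comp[OF Z] L.idn_left[OF h]
        by (auto simp: hom_def)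
      then show ?thesis
        by (rule divide[OF h hpc s _ IH])
    qed
  qed
  then show ?thesis using p by simp
qed

lemma loc_functor_hom:
  assumes "category B" "S \<subseteq> Arr B" "f \<in> hom B X Y"
  shows "farr (loc_functor B S) f \<in> hom (localization B S) X Y"
  using functor_hom[OF loc_functor_functor[OF assms(1,2)] assms(3)] assms
    category.dom_in[OF assms(1)] category.cod_in[OF assms(1)]
  by (auto simp: loc_functor_def hom_def)

section \<open>Cofibrant and fibrant objects\<close>

context model_structure
begin

abbreviation "TCofib \<equiv> Cofib \<inter> Weq"
abbreviation "TFib \<equiv> Fib \<inter> Weq"

lemma Weq_Arr: "Weq \<subseteq> Arr C" and Cofib_Arr: "Cofib \<subseteq> Arr C" and Fib_Arr: "Fib \<subseteq> Arr C"
  using wide by (auto simp: wide_subcategory_def)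

lemma Idn_Weq: "X \<in> Ob C \<Longrightarrow> Idn C X \<in> Weq"
  using wide by (auto simp: wide_subcategory_def)

lemma Weq_comp:
  assumes "f \<in> hom C X Y" "g \<in> hom C Y Z"
  shows "f \<in> Weq \<Longrightarrow> g \<in> Weq \<Longrightarrow> g \<cdot> f \<in> Weq"
    and "f \<in> Weq \<Longrightarrow> g \<cdot> f \<in> Weq \<Longrightarrow> g \<in> Weq"
    and "g \<in> Weq \<Longrightarrow> g \<cdot> f \<in> Weq \<Longrightarrow> f \<in> Weq"
  using CM1 assms by (auto simp: two_of_three_def hom_def)

lemma lifting:
  assumes "has_lifting C i p" "i \<in> hom C X Y" "p \<in> hom C E B"
    "a \<in> hom C X E" "b \<in> hom C Y B" "p \<cdot> a = b \<cdot> i"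
  obtains h where "h \<in> hom C Y E" "h \<cdot> i = a" "p \<cdot> h = b"
  using assms by (auto simp: has_lifting_def hom_def)

lemma factor_cofib_tfib:
  assumes "f \<in> hom C X Y"
  obtains Z i p where "i \<in> Cofib" "i \<in> hom C X Z" "p \<in> TFib" "p \<in> hom C Z Y" "p \<cdot> i = f"
proof -
  obtain i p where "i \<in> Cofib" "p \<in> TFib" "Cod C i = Dom C p" "f = p \<cdot> i"
    using CM4(1)[of f] assms by (auto simp: hom_def)
  moreover from this have "i \<in> hom C X (Cod C i)" "p \<in> hom C (Cod C i) Y"
    using assms Cofib_Arr Fib_Arr by (auto simp: cat_simps subset_iff)
  ultimately show thesis using that by blast
qed

lemma factor_tcofib_fib:
  assumes "f \<in> hom C X Y"
  obtains Z i p where "i \<in> TCofib" "i \<in> hom C X Z" "p \<in> Fib" "p \<in> hom C Z Y" "p \<cdot> i = f"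
proof -
  obtain i p where "i \<in> TCofib" "p \<in> Fib" "Cod C i = Dom C p" "f = p \<cdot> i"
    using CM4(2)[of f] assms by (auto simp: hom_def)
  moreover from this have "i \<in> hom C X (Cod C i)" "p \<in> hom C (Cod C i) Y"
    using assms Cofib_Arr Fib_Arr by (auto simp: cat_simps subset_iff)
  ultimately show thesis using that by blast
qed

text \<open>Lifting conditions in place of the usual conditions on the maps from the initial and to the
  terminal object: they can be checked one component at a time in a power.\<close>

definition cofibrant :: "'o \<Rightarrow> bool" where
  "cofibrant X \<longleftrightarrow> X \<in> Ob C \<and>
     (\<forall>p \<in> TFib. \<forall>b \<in> hom C X (Cod C p). \<exists>h \<in> hom C X (Dom C p). p \<cdot> h = b)"

definition fibrant :: "'o \<Rightarrow> bool" where
  "fibrant Y \<longleftrightarrow> Y \<in> Ob C \<and>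
     (\<forall>i \<in> TCofib. \<forall>a \<in> hom C (Dom C i) Y. \<exists>h \<in> hom C (Cod C i) Y. h \<cdot> i = a)"

definition cofibrant_replacement :: "'o \<Rightarrow> 'm \<Rightarrow> bool" where
  "cofibrant_replacement X q \<longleftrightarrow> q \<in> TFib \<and> Cod C q = X \<and> cofibrant (Dom C q)"

definition fibrant_replacement :: "'o \<Rightarrow> 'm \<Rightarrow> bool" where
  "fibrant_replacement Y j \<longleftrightarrow> j \<in> TCofib \<and> Dom C j = Y \<and> fibrant (Cod C j)"

lemma cofibrant_lift:
  assumes "cofibrant X" "p \<in> TFib" "p \<in> hom C E B" "b \<in> hom C X B"
  obtains h where "h \<in> hom C X E" "p \<cdot> h = b"
  using assms by (auto simp: cofibrant_def hom_def)

lemma fibrant_extend: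
  assumes "fibrant E" "i \<in> TCofib" "i \<in> hom C X Y" "a \<in> hom C X E"
  obtains h where "h \<in> hom C Y E" "h \<cdot> i = a"
  using assms by (auto simp: fibrant_def hom_def)

lemma cofibrant_replacement_exists:
  assumes "has_finite_coproducts C" "X \<in> Ob C"
  obtains q where "cofibrant_replacement X q"
proof -
  obtain Z where Z: "Z \<in> Ob C" "\<And>T. T \<in> Ob C \<Longrightarrow> \<exists>!u. u \<in> hom C Z T"
    \<comment> \<open>The coproduct of the empty family, whose objects are immaterial, is initial.\<close>
    using assms(1)[unfolded has_finite_coproducts_def, rule_format, of "\<lambda>_. undefined" 0]
    by (auto simp: is_coproduct_def)
  obtain f where f: "f \<in> hom C Z X" using ex1_implies_ex[OF Z(2)[OF assms(2)]] by blast
  obtain Q i p where ip: "i \<in> Cofib" "i \<in> hom C Z Q" "p \<in> TFib" "p \<in> hom C Q X" "p \<cdot> i = f"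
    using factor_cofib_tfib[OF f] .
  have "\<exists>h \<in> hom C Q (Dom C r). r \<cdot> h = b" if r: "r \<in> TFib" and b: "b \<in> hom C Q (Cod C r)" for r b
  proof -
    have rh: "r \<in> hom C (Dom C r) (Cod C r)" using r Fib_Arr by (auto simp: hom_def)
    then obtain a where a: "a \<in> hom C Z (Dom C r)" using Z(2)[of "Dom C r"] dom_in by (auto simp: hom_def)
    have "r \<cdot> a = b \<cdot> i"
      using Z(2)[of "Cod C r"] comp_hom[OF a rh] comp_hom[OF ip(2) b] rh cod_in by (auto simp: hom_def)
    then show ?thesis using lifting[OF CM3(1)[OF ip(1) r] ip(2) rh a b] by blast
  qed
  moreover have "Q \<in> Ob C" using ip(4) dom_in by (auto simp: hom_def)
  ultimately have "cofibrant_replacement X p"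
    using ip(3) homD[OF ip(4)] by (auto simp: cofibrant_replacement_def cofibrant_def)
  then show thesis by (rule that)
qed

lemma fibrant_replacement_exists:
  assumes "has_finite_products C" "Y \<in> Ob C"
  obtains j where "fibrant_replacement Y j"
proof -
  obtain Z where Z: "Z \<in> Ob C" "\<And>T. T \<in> Ob C \<Longrightarrow> \<exists>!u. u \<in> hom C T Z"
    \<comment> \<open>The product of the empty family, whose objects are immaterial, is terminal.\<close>
    using assms(1)[unfolded has_finite_products_def, rule_format, of "\<lambda>_. undefined" 0]
    by (auto simp: is_product_def)
  obtain f where f: "f \<in> hom C Y Z" using ex1_implies_ex[OF Z(2)[OF assms(2)]] by blast
  obtain R i p where ip: "i \<in> TCofib" "i \<in> hom C Y R" "p \<in> Fib" "p \<in> hom C R Z" "p \<cdot> i = f"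
    using factor_tcofib_fib[OF f] .
  have "\<exists>h \<in> hom C (Cod C r) R. h \<cdot> r = a" if r: "r \<in> TCofib" and a: "a \<in> hom C (Dom C r) R" for r a
  proof -
    have rh: "r \<in> hom C (Dom C r) (Cod C r)" using r Cofib_Arr by (auto simp: hom_def)
    then obtain b where b: "b \<in> hom C (Cod C r) Z" using Z(2)[of "Cod C r"] cod_in by (auto simp: hom_def)
    have "p \<cdot> a = b \<cdot> r"
      using Z(2)[of "Dom C r"] comp_hom[OF a ip(4)] comp_hom[OF rh b] rh dom_in by (auto simp: hom_def)
    then show ?thesis using lifting[OF CM3(2)[OF r ip(3)] rh ip(4) a b] by blast
  qed
  moreover have "R \<in> Ob C" using ip(2) cod_in by (auto simp: hom_def)
  ultimately have "fibrant_replacement Y i"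
    using ip(1) homD[OF ip(2)] by (auto simp: fibrant_replacement_def fibrant_def)
  then show thesis by (rule that)
qed

text \<open>A trivial cofibration out of a fibrant object has a retraction. An arrow from a cofibrant
  object into \<open>Y'\<close> is thus divided by \<open>h\<close> in the homotopy category: lift it through \<open>p\<close>, apply \<open>r\<close>.\<close>

lemma weq_fibrant_decompose:
  assumes "fibrant Y" "h \<in> Weq" "h \<in> hom C Y Y'"
  obtains Z i r p where "i \<in> TCofib" "i \<in> hom C Y Z" "r \<in> hom C Z Y" "r \<cdot> i = Idn C Y"
    "p \<in> TFib" "p \<in> hom C Z Y'" "p \<cdot> i = h"
proof -
  obtain Z i p where ip: "i \<in> TCofib" "i \<in> hom C Y Z" "p \<in> Fib" "p \<in> hom C Z Y'" "p \<cdot> i = h"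
    using factor_tcofib_fib[OF assms(3)] .
  moreover have "p \<in> Weq" using Weq_comp(2)[OF ip(2,4)] ip assms by auto
  moreover obtain r where "r \<in> hom C Z Y" "r \<cdot> i = Idn C Y"
    using fibrant_extend[OF assms(1) ip(1,2) idn_hom] assms(1) by (auto simp: fibrant_def)
  ultimately show thesis using that by blast
qed

section \<open>Representing arrows of the homotopy category\<close>

abbreviation "L \<equiv> localization C Weq"
abbreviation "loc f \<equiv> farr (loc_functor C Weq) f"

lemma L_cat: "category L"
  by (rule category_localization[OF category_axioms Weq_Arr])

lemma loc_hom: "f \<in> hom C X Y \<Longrightarrow> loc f \<in> hom L X Y"
  by (rule loc_functor_hom[OF category_axioms Weq_Arr])

lemma loc_comp_arr: "f \<in> hom C X Y \<Longrightarrow> g \<in> hom C Y Z \<Longrightarrow> loc (g \<cdot> f) = loc g \<cdot>\<^bsub>L\<^esub> loc f"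
  by (rule functor_comp[OF loc_functor_functor[OF category_axioms Weq_Arr]])

lemma loc_comp_assoc:
  assumes "a \<in> hom L W X" "f \<in> hom C X Y" "g \<in> hom C Y Z"
  shows "loc (g \<cdot> f) \<cdot>\<^bsub>L\<^esub> a = loc g \<cdot>\<^bsub>L\<^esub> (loc f \<cdot>\<^bsub>L\<^esub> a)"
  using category.assoc[OF L_cat assms(1) loc_hom[OF assms(2)] loc_hom[OF assms(3)]]
    loc_comp_arr[OF assms(2,3)] by simp

lemma loc_iso: "s \<in> Weq \<Longrightarrow> is_iso L (loc s)"
  by (rule loc_functor_inverts[OF category_axioms Weq_Arr])

text \<open>By induction along a zigzag: a forward step extends over fibrant replacements; a backward step
  becomes a weak equivalence \<open>p \<cdot> i\<close> between fibrant objects, which is divided out by lifting through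
  the trivial fibration \<open>p\<close>, the source \<open>X\<close> being cofibrant, and then applying a retraction of \<open>i\<close>.
  The zigzag thus shrinks to a single arrow.\<close>

theorem loc_arrow_representable:
  assumes X: "cofibrant X" and R: "\<And>Y. Y \<in> Ob C \<Longrightarrow> \<exists>j. fibrant_replacement Y j"
    and a: "a \<in> hom L X Y" and j: "fibrant_replacement Y j"
  obtains f where "f \<in> hom C X (Cod C j)" "loc f = loc j \<cdot>\<^bsub>L\<^esub> a"
proof -
  interpret L: category L by (rule L_cat)
  have jh: "j \<in> hom C Y (Cod C j)" "j \<in> TCofib" "fibrant (Cod C j)" if "fibrant_replacement Y j" for j Y
    using that Cofib_Arr by (auto simp: fibrant_replacement_def hom_def)
  from category_axioms Weq_Arr a have "\<forall>j. fibrant_replacement Y j \<longrightarrow> (\<exists>f \<in> hom C X (Cod C j). loc f = loc j \<cdot>\<^bsub>L\<^esub> a)"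
  proof (induction rule: loc_hom_induct)
    case idn
    show ?case
    proof (intro allI impI)
      fix j assume "fibrant_replacement X j"
      then have "j \<in> hom C X (Cod C j)" by (rule jh(1))
      then show "\<exists>f \<in> hom C X (Cod C j). loc f = loc j \<cdot>\<^bsub>L\<^esub> Idn L X"
        using L.idn_right[OF loc_hom] by (intro bexI[of _ j]) auto
    qed
  next
    case (comp a g Y Z)
    show ?case
    proof (intro allI impI)
      fix j assume j: "fibrant_replacement Z j"
      have "Y \<in> Ob C" using comp(2) by (auto simp: hom_def dom_in)
      then obtain j' where j': "fibrant_replacement Y j'" using R by blast
      then obtain f where f: "f \<in> hom C X (Cod C j')" "loc f = loc j' \<cdot>\<^bsub>L\<^esub> a" using comp.IH by blast
      have jg: "j \<cdot> g \<in> hom C Y (Cod C j)" using comp_hom[OF comp(2) jh(1)[OF j]] .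
      obtain h where h: "h \<in> hom C (Cod C j') (Cod C j)" "h \<cdot> j' = j \<cdot> g"
        using fibrant_extend[OF jh(3)[OF j] jh(2,1)[OF j'] jg] .
      have "loc (h \<cdot> f) = loc h \<cdot>\<^bsub>L\<^esub> (loc j' \<cdot>\<^bsub>L\<^esub> a)" using loc_comp_arr[OF f(1) h(1)] f by simp
      also have "\<dots> = loc (h \<cdot> j') \<cdot>\<^bsub>L\<^esub> a"
        using loc_comp_assoc[OF comp(1) jh(1)[OF j'] h(1)] by simp
      also have "\<dots> = loc j \<cdot>\<^bsub>L\<^esub> (loc g \<cdot>\<^bsub>L\<^esub> a)"
        using h(2) loc_comp_assoc[OF comp(1,2) jh(1)[OF j]] by simp
      finally show "\<exists>f \<in> hom C X (Cod C j). loc f = loc j \<cdot>\<^bsub>L\<^esub> (loc g \<cdot>\<^bsub>L\<^esub> a)"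
        using comp_hom[OF f(1) h(1)] by blast
    qed
  next
    case (divide a b s Y Z)
    show ?case
    proof (intro allI impI)
      fix j assume j: "fibrant_replacement Z j"
      have "Y \<in> Ob C" using divide(4) by (auto simp: hom_def cod_in)
      then obtain j' where j': "fibrant_replacement Y j'" using R by blast
      then obtain f where f: "f \<in> hom C X (Cod C j')" "loc f = loc j' \<cdot>\<^bsub>L\<^esub> a" using divide.IH by blast
      note jj = jh[OF j] and jj' = jh[OF j']
      have js: "j' \<cdot> s \<in> hom C Z (Cod C j')" using comp_hom[OF divide(4) jj'(1)] .
      have jsW: "j' \<cdot> s \<in> Weq" using Weq_comp(1)[OF divide(4) jj'(1)] jj'(2) divide(3) by blast
      obtain h where h: "h \<in> hom C (Cod C j) (Cod C j')" "h \<cdot> j = j' \<cdot> s"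
        using fibrant_extend[OF jj'(3) jj(2,1) js] .
      have hW: "h \<in> Weq" using Weq_comp(2)[OF jj(1) h(1)] jj(2) jsW h(2) by simp
      obtain T i r p where d: "i \<in> TCofib" "i \<in> hom C (Cod C j) T" "r \<in> hom C T (Cod C j)"
        "r \<cdot> i = Idn C (Cod C j)" "p \<in> TFib" "p \<in> hom C T (Cod C j')" "p \<cdot> i = h"
        using weq_fibrant_decompose[OF jj(3) hW h(1)] .
      obtain f' where f': "f' \<in> hom C X T" "p \<cdot> f' = f" using cofibrant_lift[OF X d(5,6) f(1)] .
      have rf: "r \<cdot> f' \<in> hom C X (Cod C j)" using comp_hom f' d by blast
      have T: "T \<in> Ob L" using d(2) cod_in by (auto simp: loc_simps hom_def)
      \<comment> \<open>The retraction \<open>r\<close> becomes the inverse of \<open>i\<close>, so \<open>i \<cdot> r\<close> becomes an identity.\<close>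
      have "loc (i \<cdot> r) \<cdot>\<^bsub>L\<^esub> loc i = Idn L T \<cdot>\<^bsub>L\<^esub> loc i"
        using d loc_comp_arr[OF d(2) comp_hom[OF d(3,2)]] assoc[OF d(2,3,2)] idn_right[OF d(2)]
          L.idn_left[OF loc_hom[OF d(2)]] by simp
      then have ir: "loc (i \<cdot> r) = Idn L T"
        using L.iso_cancel_right[OF loc_iso loc_hom[OF d(2)] loc_hom[OF comp_hom[OF d(3,2)]] L.idn_hom[OF T]] d(1)
        by blast
      note rf' = loc_comp_assoc[OF loc_hom[OF f'(1)] d(3,2)] and pi = loc_comp_assoc[OF loc_hom[OF rf] d(2,6)]
      have "loc h \<cdot>\<^bsub>L\<^esub> loc (r \<cdot> f') = loc p \<cdot>\<^bsub>L\<^esub> (loc (i \<cdot> r) \<cdot>\<^bsub>L\<^esub> loc f')"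
        using pi rf' d(7) loc_comp_arr[OF f'(1) d(3)] by simp
      also have "\<dots> = loc f"
        using ir L.idn_left[OF loc_hom[OF f'(1)]] loc_comp_arr[OF f'(1) d(6)] f' by simp
      also have "\<dots> = loc (j' \<cdot> s) \<cdot>\<^bsub>L\<^esub> b"
        using f(2) divide(5) loc_comp_assoc[OF divide(2,4) jj'(1)] by simp
      also have "\<dots> = loc h \<cdot>\<^bsub>L\<^esub> (loc j \<cdot>\<^bsub>L\<^esub> b)"
        using h(2) loc_comp_assoc[OF divide(2) jj(1) h(1)] by simp
      finally have "loc (r \<cdot> f') = loc j \<cdot>\<^bsub>L\<^esub> b"
        using L.iso_cancel_left[OF loc_iso[OF hW] loc_hom[OF h(1)] loc_hom[OF rf]]
          L.comp_hom[OF divide(2) loc_hom[OF jj(1)]] by blast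
      then show "\<exists>f \<in> hom C X (Cod C j). loc f = loc j \<cdot>\<^bsub>L\<^esub> b" using rf by blast
    qed
  qed
  then have "\<exists>f \<in> hom C X (Cod C j). loc f = loc j \<cdot>\<^bsub>L\<^esub> a" using j by simp
  then show thesis using that by blast
qed

section \<open>Cylinders and path objects\<close>

text \<open>The lifting condition says that the map \<open>X + X \<rightarrow> T\<close> with components \<open>k\<close> and \<open>l\<close> lifts
  against trivial fibrations; dually for a path object.\<close>

definition cylinder :: "'o \<Rightarrow> 'o \<Rightarrow> 'm \<Rightarrow> 'm \<Rightarrow> 'm \<Rightarrow> bool" where
  "cylinder X T k l s \<longleftrightarrow> k \<in> hom C X T \<and> l \<in> hom C X T \<and> s \<in> Weq \<and> s \<in> hom C T X \<and>
     s \<cdot> k = Idn C X \<and> s \<cdot> l = Idn C X \<and>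
     (\<forall>p \<in> TFib. \<forall>a \<in> hom C X (Dom C p). \<forall>b \<in> hom C X (Dom C p). \<forall>c \<in> hom C T (Cod C p).
        p \<cdot> a = c \<cdot> k \<and> p \<cdot> b = c \<cdot> l \<longrightarrow>
        (\<exists>h \<in> hom C T (Dom C p). h \<cdot> k = a \<and> h \<cdot> l = b \<and> p \<cdot> h = c))"

definition path_object :: "'o \<Rightarrow> 'o \<Rightarrow> 'm \<Rightarrow> 'm \<Rightarrow> 'm \<Rightarrow> bool" where
  "path_object Y P u v s \<longleftrightarrow> u \<in> hom C P Y \<and> v \<in> hom C P Y \<and> s \<in> Weq \<and> s \<in> hom C Y P \<and>
     u \<cdot> s = Idn C Y \<and> v \<cdot> s = Idn C Y \<and>
     (\<forall>i \<in> TCofib. \<forall>a \<in> hom C (Dom C i) P. \<forall>b \<in> hom C (Cod C i) Y. \<forall>c \<in> hom C (Cod C i) Y.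
        u \<cdot> a = b \<cdot> i \<and> v \<cdot> a = c \<cdot> i \<longrightarrow>
        (\<exists>h \<in> hom C (Cod C i) P. h \<cdot> i = a \<and> u \<cdot> h = b \<and> v \<cdot> h = c))"

lemma cylinder_lift:
  assumes "cylinder X T k l s" "p \<in> TFib" "p \<in> hom C E B" "a \<in> hom C X E" "b \<in> hom C X E"
    "c \<in> hom C T B" "p \<cdot> a = c \<cdot> k" "p \<cdot> b = c \<cdot> l"
  obtains h where "h \<in> hom C T E" "h \<cdot> k = a" "h \<cdot> l = b" "p \<cdot> h = c"
proof -
  have "Dom C p = E" "Cod C p = B" using assms(3) by (auto simp: hom_def)
  then have "\<exists>h \<in> hom C T E. h \<cdot> k = a \<and> h \<cdot> l = b \<and> p \<cdot> h = c"
    using assms unfolding cylinder_def by blast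
  then show thesis using that by blast
qed

lemma path_object_lift:
  assumes "path_object Y P u v s" "i \<in> TCofib" "i \<in> hom C A B" "a \<in> hom C A P" "b \<in> hom C B Y"
    "c \<in> hom C B Y" "u \<cdot> a = b \<cdot> i" "v \<cdot> a = c \<cdot> i"
  obtains h where "h \<in> hom C B P" "h \<cdot> i = a" "u \<cdot> h = b" "v \<cdot> h = c"
proof -
  have "Dom C i = A" "Cod C i = B" using assms(3) by (auto simp: hom_def)
  then have "\<exists>h \<in> hom C B P. h \<cdot> i = a \<and> u \<cdot> h = b \<and> v \<cdot> h = c"
    using assms unfolding path_object_def by blast
  then show thesis using that by blast
qed

lemma path_object_swap: "path_object Y P u v s \<Longrightarrow> path_object Y P v u s"
  unfolding path_object_def by blast

lemma cylinder_exists: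
  assumes "has_finite_coproducts C" "X \<in> Ob C"
  obtains T k l s where "cylinder X T k l s"
proof -
  obtain Z d e where de: "d \<in> hom C X Z" "e \<in> hom C X Z"
    and Z: "\<And>T a b. a \<in> hom C X T \<Longrightarrow> b \<in> hom C X T \<Longrightarrow> \<exists>!u. u \<in> hom C Z T \<and> u \<cdot> d = a \<and> u \<cdot> e = b"
    by (rule binary_coproduct[OF assms]) (rule that)
  obtain t where t: "t \<in> hom C Z X" "t \<cdot> d = Idn C X" "t \<cdot> e = Idn C X"
    using Z[OF idn_hom idn_hom] assms(2) by blast
  obtain T m s where m: "m \<in> Cofib" "m \<in> hom C Z T" "s \<in> TFib" "s \<in> hom C T X" "s \<cdot> m = t"
    using factor_cofib_tfib[OF t(1)] .
  have "\<exists>h \<in> hom C T (Dom C p). h \<cdot> (m \<cdot> d) = a \<and> h \<cdot> (m \<cdot> e) = b \<and> p \<cdot> h = c"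
    if p: "p \<in> TFib" and ab: "a \<in> hom C X (Dom C p)" "b \<in> hom C X (Dom C p)"
      and c: "c \<in> hom C T (Cod C p)" and eq: "p \<cdot> a = c \<cdot> (m \<cdot> d)" "p \<cdot> b = c \<cdot> (m \<cdot> e)" for p a b c
  proof -
    have ph: "p \<in> hom C (Dom C p) (Cod C p)" using p Fib_Arr by (auto simp: hom_def)
    obtain w where w: "w \<in> hom C Z (Dom C p)" "w \<cdot> d = a" "w \<cdot> e = b" using Z[OF ab] by blast
    have "(p \<cdot> w) \<cdot> d = p \<cdot> a" "(p \<cdot> w) \<cdot> e = p \<cdot> b" "(c \<cdot> m) \<cdot> d = p \<cdot> a" "(c \<cdot> m) \<cdot> e = p \<cdot> b"
      using assoc[OF _ w(1) ph] assoc[OF _ m(2) c] de w eq by auto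
    then have "p \<cdot> w = c \<cdot> m"
      using Z[OF comp_hom[OF ab(1) ph] comp_hom[OF ab(2) ph]] comp_hom[OF w(1) ph] comp_hom[OF m(2) c]
      by blast
    from lifting[OF CM3(1)[OF m(1) p] m(2) ph w(1) c this]
    obtain h where h: "h \<in> hom C T (Dom C p)" "h \<cdot> m = w" "p \<cdot> h = c" .
    then have "h \<cdot> (m \<cdot> d) = a" "h \<cdot> (m \<cdot> e) = b"
      using assoc[OF de(1) m(2) h(1)] assoc[OF de(2) m(2) h(1)] w by auto
    then show ?thesis using h by blast
  qed
  moreover have "s \<cdot> (m \<cdot> d) = Idn C X" "s \<cdot> (m \<cdot> e) = Idn C X"
    using assoc[OF de(1) m(2,4)] assoc[OF de(2) m(2,4)] m(5) t by auto
  ultimately have "cylinder X T (m \<cdot> d) (m \<cdot> e) s"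
    using m comp_hom[OF de(1) m(2)] comp_hom[OF de(2) m(2)] unfolding cylinder_def by auto
  then show thesis by (rule that)
qed

lemma path_object_exists:
  assumes "has_finite_products C" "Y \<in> Ob C"
  obtains P u v s where "path_object Y P u v s"
proof -
  obtain Z d e where de: "d \<in> hom C Z Y" "e \<in> hom C Z Y"
    and Z: "\<And>T a b. a \<in> hom C T Y \<Longrightarrow> b \<in> hom C T Y \<Longrightarrow> \<exists>!u. u \<in> hom C T Z \<and> d \<cdot> u = a \<and> e \<cdot> u = b"
    by (rule binary_product[OF assms]) (rule that)
  obtain t where t: "t \<in> hom C Y Z" "d \<cdot> t = Idn C Y" "e \<cdot> t = Idn C Y"
    using Z[OF idn_hom idn_hom] assms(2) by blast
  obtain P s m where m: "s \<in> TCofib" "s \<in> hom C Y P" "m \<in> Fib" "m \<in> hom C P Z" "m \<cdot> s = t"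
    using factor_tcofib_fib[OF t(1)] .
  have "\<exists>h \<in> hom C (Cod C i) P. h \<cdot> i = a \<and> (d \<cdot> m) \<cdot> h = b \<and> (e \<cdot> m) \<cdot> h = c"
    if i: "i \<in> TCofib" and a: "a \<in> hom C (Dom C i) P" and bc: "b \<in> hom C (Cod C i) Y"
      "c \<in> hom C (Cod C i) Y" and eq: "(d \<cdot> m) \<cdot> a = b \<cdot> i" "(e \<cdot> m) \<cdot> a = c \<cdot> i" for i a b c
  proof -
    have ih: "i \<in> hom C (Dom C i) (Cod C i)" using i Cofib_Arr by (auto simp: hom_def)
    obtain w where w: "w \<in> hom C (Cod C i) Z" "d \<cdot> w = b" "e \<cdot> w = c" using Z[OF bc] by blast
    have "d \<cdot> (w \<cdot> i) = b \<cdot> i" "e \<cdot> (w \<cdot> i) = c \<cdot> i" "d \<cdot> (m \<cdot> a) = b \<cdot> i" "e \<cdot> (m \<cdot> a) = c \<cdot> i"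
      using assoc[OF ih w(1)] assoc[OF a m(4)] de w eq by auto
    then have "m \<cdot> a = w \<cdot> i"
      using Z[OF comp_hom[OF ih bc(1)] comp_hom[OF ih bc(2)]] comp_hom[OF ih w(1)] comp_hom[OF a m(4)]
      by blast
    from lifting[OF CM3(2)[OF i m(3)] ih m(4) a w(1) this]
    obtain h where h: "h \<in> hom C (Cod C i) P" "h \<cdot> i = a" "m \<cdot> h = w" .
    then have "(d \<cdot> m) \<cdot> h = b" "(e \<cdot> m) \<cdot> h = c"
      using assoc[OF h(1) m(4) de(1)] assoc[OF h(1) m(4) de(2)] w by auto
    then show ?thesis using h by blast
  qed
  moreover have "(d \<cdot> m) \<cdot> s = Idn C Y" "(e \<cdot> m) \<cdot> s = Idn C Y"
    using assoc[OF m(2,4) de(1)] assoc[OF m(2,4) de(2)] m(5) t by auto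
  ultimately have "path_object Y P (d \<cdot> m) (e \<cdot> m) s"
    using m comp_hom[OF m(4) de(1)] comp_hom[OF m(4) de(2)] unfolding path_object_def by auto
  then show thesis by (rule that)
qed

text \<open>The retraction makes \<open>k\<close> lift against whatever the trivial cofibration \<open>w\<close> lifts against. In a
  factorization \<open>q \<cdot> w = k\<close> the fibration \<open>q\<close> is trivial by two-of-three, so the identity of \<open>T\<close> lifts through it
  relative to the two ends: on \<open>k\<close> the lift is \<open>w\<close>, on \<open>l\<close> it is found by cofibrancy of \<open>X\<close>.\<close>

lemma cylinder_inclusion_retract:
  assumes "cofibrant X" "cylinder X T k l s"
  obtains Z w q d where "w \<in> TCofib" "w \<in> hom C X Z" "q \<in> hom C Z T" "d \<in> hom C T Z"
    "q \<cdot> w = k" "d \<cdot> k = w" "q \<cdot> d = Idn C T"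
proof -
  note c = assms(2)[unfolded cylinder_def]
  have k: "k \<in> hom C X T" and l: "l \<in> hom C X T" and X: "X \<in> Ob C" and T: "T \<in> Ob C"
    using c assms(1) dom_in[of s] by (auto simp: cofibrant_def hom_def)
  have "k \<in> Weq" using Weq_comp(3)[of k X T s X] Idn_Weq[OF X] c by simp
  obtain Z w q where w: "w \<in> TCofib" "w \<in> hom C X Z" "q \<in> Fib" "q \<in> hom C Z T" "q \<cdot> w = k"
    using factor_tcofib_fib[OF k] .
  have q: "q \<in> TFib" using Weq_comp(2)[OF w(2,4)] w \<open>k \<in> Weq\<close> by auto
  obtain b where b: "b \<in> hom C X Z" "q \<cdot> b = l" using cofibrant_lift[OF assms(1) q w(4) l] .
  have "q \<cdot> w = Idn C T \<cdot> k" "q \<cdot> b = Idn C T \<cdot> l" using w b idn_left[OF k] idn_left[OF l] by auto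
  from cylinder_lift[OF assms(2) q w(4) w(2) b(1) idn_hom[OF T] this]
  obtain d where "d \<in> hom C T Z" "d \<cdot> k = w" "d \<cdot> l = b" "q \<cdot> d = Idn C T" .
  then show thesis using that w by blast
qed

text \<open>Dually, the projection \<open>u\<close> inherits the lifting property of a trivial fibration.\<close>

lemma path_projection_retract:
  assumes "fibrant Y" "path_object Y P u v s"
  obtains Z q z d where "q \<in> TFib" "q \<in> hom C Z Y" "z \<in> hom C P Z" "d \<in> hom C Z P"
    "q \<cdot> z = u" "u \<cdot> d = q" "d \<cdot> z = Idn C P"
proof -
  note c = assms(2)[unfolded path_object_def]
  have u: "u \<in> hom C P Y" and v: "v \<in> hom C P Y" and Y: "Y \<in> Ob C" and P: "P \<in> Ob C"
    using c assms(1) dom_in by (auto simp: fibrant_def hom_def)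
  have "u \<in> Weq" using Weq_comp(2)[of s Y P u Y] Idn_Weq[OF Y] c by simp
  obtain Z z q where w: "z \<in> Cofib" "z \<in> hom C P Z" "q \<in> TFib" "q \<in> hom C Z Y" "q \<cdot> z = u"
    using factor_cofib_tfib[OF u] .
  have z: "z \<in> TCofib" using Weq_comp(3)[OF w(2,4)] w \<open>u \<in> Weq\<close> by auto
  obtain b where b: "b \<in> hom C Z Y" "b \<cdot> z = v" using fibrant_extend[OF assms(1) z w(2) v] .
  have "u \<cdot> Idn C P = q \<cdot> z" "v \<cdot> Idn C P = b \<cdot> z" using w b idn_right[OF u] idn_right[OF v] by auto
  from path_object_lift[OF assms(2) z w(2) idn_hom[OF P] w(4) b(1) this]
  obtain d where "d \<in> hom C Z P" "d \<cdot> z = Idn C P" "u \<cdot> d = q" "v \<cdot> d = b" .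
  then show thesis using that w by blast
qed

end

section \<open>Left homotopy\<close>

locale left_homotopy = model_structure +
  fixes X T :: 'a and k l s :: 'b
  assumes X_cofibrant: "cofibrant X"
    and cyl: "cylinder X T k l s"
    and paths: "\<And>Y. fibrant Y \<Longrightarrow> \<exists>P u v t. path_object Y P u v t"
begin

lemma cyl_hom: "k \<in> hom C X T" "l \<in> hom C X T" "s \<in> hom C T X" "s \<cdot> k = Idn C X" "s \<cdot> l = Idn C X"
  using cyl by (auto simp: cylinder_def)

lemmas cyl_simps = homD[OF cyl_hom(1)] homD[OF cyl_hom(2)] homD[OF cyl_hom(3)] cyl_hom(4,5)

definition htp :: "'b \<Rightarrow> 'b \<Rightarrow> bool" where
  "htp f g \<longleftrightarrow> (\<exists>H \<in> hom C T (Cod C f). H \<cdot> k = f \<and> H \<cdot> l = g)"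

lemma htpI: "H \<in> hom C T Y \<Longrightarrow> H \<cdot> k = f \<Longrightarrow> H \<cdot> l = g \<Longrightarrow> htp f g"
  using cyl_simps by (auto simp: htp_def hom_def comp_arr)

lemma htpE:
  assumes "htp f g" "f \<in> hom C X Y"
  obtains H where "H \<in> hom C T Y" "H \<cdot> k = f" "H \<cdot> l = g"
  using assms by (auto simp: htp_def hom_def)

lemma htp_hom: "htp f g \<Longrightarrow> f \<in> hom C X Y \<Longrightarrow> g \<in> hom C X Y"
  using comp_hom[OF cyl_hom(2)] by (metis htpE)

lemma htp_refl:
  assumes "f \<in> hom C X Y"
  shows "htp f f"
  using assms cyl_simps by (intro htpI[of "f \<cdot> s" Y]) (auto simp: cat_simps)

lemma htp_comp:
  assumes "htp f g" "f \<in> hom C X Y" "h \<in> hom C Y Z"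
  shows "htp (h \<cdot> f) (h \<cdot> g)"
proof -
  obtain H where H: "H \<in> hom C T Y" "H \<cdot> k = f" "H \<cdot> l = g" using htpE[OF assms(1,2)] .
  then show ?thesis
    using assoc[OF cyl_hom(1) H(1) assms(3)] assoc[OF cyl_hom(2) H(1) assms(3)]
    by (intro htpI[OF comp_hom[OF H(1) assms(3)]]) auto
qed

text \<open>The homotopy \<open>H\<close> is moved to the second component of a map \<open>T \<rightarrow> P\<close> whose first component is
  constant at \<open>f\<close>. At the end \<open>k\<close> that map is the constant path of \<open>f\<close>, so it exists by lifting
  \<open>k\<close> against the projections of \<open>P\<close>; its restriction to the end \<open>l\<close> is \<open>\<kappa>\<close>.\<close>

lemma htp_imp_path:
  assumes f: "f \<in> hom C X Y" and fg: "htp f g" and P: "path_object Y P u v t"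
  obtains \<kappa> where "\<kappa> \<in> hom C X P" "u \<cdot> \<kappa> = f" "v \<cdot> \<kappa> = g"
proof -
  note p = P[unfolded path_object_def]
  have t: "t \<in> hom C Y P" and u: "u \<in> hom C P Y" and v: "v \<in> hom C P Y" and ut: "u \<cdot> t = Idn C Y"
    and vt: "v \<cdot> t = Idn C Y"
    using p by auto
  obtain H where H: "H \<in> hom C T Y" "H \<cdot> k = f" "H \<cdot> l = g" using htpE[OF fg f] .
  obtain Z w q d where w: "w \<in> TCofib" "w \<in> hom C X Z" "q \<in> hom C Z T" "d \<in> hom C T Z"
    "q \<cdot> w = k" "d \<cdot> k = w" "q \<cdot> d = Idn C T"
    using cylinder_inclusion_retract[OF X_cofibrant cyl] .
  have a: "t \<cdot> f \<in> hom C X P" and b: "f \<cdot> (s \<cdot> q) \<in> hom C Z Y" and c: "H \<cdot> q \<in> hom C Z Y"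
    using f t H w cyl_hom by (auto intro: comp_hom)
  have "u \<cdot> (t \<cdot> f) = (f \<cdot> (s \<cdot> q)) \<cdot> w" "v \<cdot> (t \<cdot> f) = (H \<cdot> q) \<cdot> w"
    using f t u v w H cyl_simps reassoc[OF ut t u] reassoc[OF vt t v]
    by (auto simp: cat_simps)
  from path_object_lift[OF P w(1,2) a b c this]
  obtain h where h: "h \<in> hom C Z P" "h \<cdot> w = t \<cdot> f" "u \<cdot> h = f \<cdot> (s \<cdot> q)" "v \<cdot> h = H \<cdot> q" .
  have "u \<cdot> (h \<cdot> (d \<cdot> l)) = f" "v \<cdot> (h \<cdot> (d \<cdot> l)) = g"
    using f u v w H h cyl_simps reassoc[OF h(3,1) u] reassoc[OF h(4,1) v] reassoc[OF w(7,4,3)]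
    by (auto simp: cat_simps)
  moreover have "h \<cdot> (d \<cdot> l) \<in> hom C X P" using h w cyl_hom by (auto intro: comp_hom)
  ultimately show thesis using that by blast
qed

text \<open>The homotopy from \<open>f\<close> to \<open>u \<cdot> \<kappa>\<close> lifts through the projection \<open>u\<close> to a map \<open>T \<rightarrow> P\<close> that is
  constant at \<open>f\<close> on one end and \<open>\<kappa>\<close> on the other; \<open>v\<close> sends it to the required homotopy. This
  replaces the gluing of two cylinders.\<close>

lemma htp_along_path:
  assumes Y: "fibrant Y" and P: "path_object Y P u v t" and \<kappa>: "\<kappa> \<in> hom C X P"
    and f: "f \<in> hom C X Y" and h: "htp f (u \<cdot> \<kappa>)"
  shows "htp f (v \<cdot> \<kappa>)"
proof -
  note p = P[unfolded path_object_def]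
  have t: "t \<in> hom C Y P" and u: "u \<in> hom C P Y" and v: "v \<in> hom C P Y" and ut: "u \<cdot> t = Idn C Y"
    and vt: "v \<cdot> t = Idn C Y"
    using p by auto
  obtain H where H: "H \<in> hom C T Y" "H \<cdot> k = f" "H \<cdot> l = u \<cdot> \<kappa>" using htpE[OF h f] .
  obtain Z q z d where w: "q \<in> TFib" "q \<in> hom C Z Y" "z \<in> hom C P Z" "d \<in> hom C Z P"
    "q \<cdot> z = u" "u \<cdot> d = q" "d \<cdot> z = Idn C P"
    using path_projection_retract[OF Y P] .
  have a: "z \<cdot> (t \<cdot> f) \<in> hom C X Z" and b: "z \<cdot> \<kappa> \<in> hom C X Z"
    using f t w \<kappa> by (auto intro: comp_hom)
  have "q \<cdot> (z \<cdot> (t \<cdot> f)) = H \<cdot> k" "q \<cdot> (z \<cdot> \<kappa>) = H \<cdot> l"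
    using f t u w H \<kappa> cyl_simps reassoc[OF ut t u] reassoc[OF w(5,3,2)] by (auto simp: cat_simps)
  from cylinder_lift[OF cyl w(1,2) a b H(1) this]
  obtain h where h: "h \<in> hom C T Z" "h \<cdot> k = z \<cdot> (t \<cdot> f)" "h \<cdot> l = z \<cdot> \<kappa>" .
  have "(v \<cdot> (d \<cdot> h)) \<cdot> k = f" "(v \<cdot> (d \<cdot> h)) \<cdot> l = v \<cdot> \<kappa>"
    using f t v w \<kappa> h cyl_simps reassoc[OF w(7,3,4)] reassoc[OF vt t v] by (auto simp: cat_simps)
  then show ?thesis
    by (intro htpI[of "v \<cdot> (d \<cdot> h)" Y]) (use v w h in \<open>auto intro: comp_hom\<close>)
qed

lemma htp_trans:
  assumes "fibrant Y" "f \<in> hom C X Y" "htp f g" "htp g h"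
  shows "htp f h"
proof -
  have g: "g \<in> hom C X Y" using htp_hom assms by blast
  obtain P u v t where P: "path_object Y P u v t" using paths[OF assms(1)] by blast
  obtain \<kappa> where \<kappa>: "\<kappa> \<in> hom C X P" "u \<cdot> \<kappa> = g" "v \<cdot> \<kappa> = h" using htp_imp_path[OF g assms(4) P] .
  then show ?thesis using htp_along_path[OF assms(1) P \<kappa>(1) assms(2)] assms(3) by simp
qed

lemma htp_sym:
  assumes "fibrant Y" "f \<in> hom C X Y" "htp f g"
  shows "htp g f"
proof -
  have g: "g \<in> hom C X Y" using htp_hom assms by blast
  obtain P u v t where P: "path_object Y P u v t" using paths[OF assms(1)] by blast
  obtain \<kappa> where \<kappa>: "\<kappa> \<in> hom C X P" "u \<cdot> \<kappa> = f" "v \<cdot> \<kappa> = g" using htp_imp_path[OF assms(2,3) P] .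
  then show ?thesis
    using htp_along_path[OF assms(1) path_object_swap[OF P] \<kappa>(1) g] htp_refl[OF g] by simp
qed

text \<open>The extensions \<open>h\<close> and \<open>h'\<close> are the two components of a lift \<open>K\<close> into a path object, and \<open>K \<cdot> f\<close>
  is a path from \<open>h \<cdot> f\<close> to \<open>h' \<cdot> f\<close>.\<close>

lemma htp_extensions:
  assumes Y: "fibrant Y" and j: "j \<in> TCofib" "j \<in> hom C A B" and h: "h \<in> hom C B Y" "h' \<in> hom C B Y"
    and eq: "h \<cdot> j = h' \<cdot> j" and f: "f \<in> hom C X B"
  shows "htp (h \<cdot> f) (h' \<cdot> f)"
proof -
  obtain P u v t where P: "path_object Y P u v t" using paths[OF Y] by blast
  note p = P[unfolded path_object_def]
  have t: "t \<in> hom C Y P" and u: "u \<in> hom C P Y" and v: "v \<in> hom C P Y" and ut: "u \<cdot> t = Idn C Y"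
    and vt: "v \<cdot> t = Idn C Y"
    using p by auto
  have a: "t \<cdot> (h \<cdot> j) \<in> hom C A P" using t h j by (auto intro: comp_hom)
  have "u \<cdot> (t \<cdot> (h \<cdot> j)) = h \<cdot> j" "v \<cdot> (t \<cdot> (h \<cdot> j)) = h' \<cdot> j"
    using t u v h j eq reassoc[OF ut t u] reassoc[OF vt t v] by (auto simp: cat_simps)
  from path_object_lift[OF P j a h this]
  obtain K where K: "K \<in> hom C B P" "K \<cdot> j = t \<cdot> (h \<cdot> j)" "u \<cdot> K = h" "v \<cdot> K = h'" .
  have "u \<cdot> (K \<cdot> f) = h \<cdot> f" "v \<cdot> (K \<cdot> f) = h' \<cdot> f"
    using assoc[OF f K(1) u] assoc[OF f K(1) v] K by auto
  then show ?thesis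
    using htp_along_path[OF Y P comp_hom[OF f K(1)] comp_hom[OF f h(1)]] htp_refl[OF comp_hom[OF f h(1)]]
    by simp
qed

text \<open>Injectivity and surjectivity on homotopy classes of a weak equivalence between fibrant objects:
  homotopies and arrows are lifted through the trivial fibration \<open>p\<close> and then retracted by \<open>r\<close>. In
  the second case \<open>i \<cdot> r\<close> is not an identity, but \<open>h \<cdot> r\<close> and \<open>p\<close> extend the same map along \<open>i\<close>.\<close>

lemma weq_reflects_htp:
  assumes Y: "fibrant Y" and h: "h \<in> Weq" "h \<in> hom C Y Y'" and f: "f \<in> hom C X Y" "g \<in> hom C X Y"
    and eq: "htp (h \<cdot> f) (h \<cdot> g)"
  shows "htp f g"
proof -
  obtain Z i r p where d: "i \<in> TCofib" "i \<in> hom C Y Z" "r \<in> hom C Z Y" "r \<cdot> i = Idn C Y"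
    "p \<in> TFib" "p \<in> hom C Z Y'" "p \<cdot> i = h"
    using weq_fibrant_decompose[OF Y h] .
  obtain H where H: "H \<in> hom C T Y'" "H \<cdot> k = h \<cdot> f" "H \<cdot> l = h \<cdot> g" using htpE[OF eq comp_hom[OF f(1) h(2)]] .
  have "p \<cdot> (i \<cdot> f) = H \<cdot> k" "p \<cdot> (i \<cdot> g) = H \<cdot> l"
    using assoc[OF f(1) d(2,6)] assoc[OF f(2) d(2,6)] d(7) H by auto
  from cylinder_lift[OF cyl d(5,6) comp_hom[OF f(1) d(2)] comp_hom[OF f(2) d(2)] H(1) this]
  obtain K where K: "K \<in> hom C T Z" "K \<cdot> k = i \<cdot> f" "K \<cdot> l = i \<cdot> g" .
  have "(r \<cdot> K) \<cdot> k = f" "(r \<cdot> K) \<cdot> l = g"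
    using K d f cyl_simps reassoc[OF d(4,2,3)] by (auto simp: cat_simps)
  then show ?thesis by (intro htpI[OF comp_hom[OF K(1) d(3)]])
qed

lemma weq_lifts_up_to_htp:
  assumes Y: "fibrant Y" "fibrant Y'" and h: "h \<in> Weq" "h \<in> hom C Y Y'" and f: "f \<in> hom C X Y'"
  obtains f' where "f' \<in> hom C X Y" "htp (h \<cdot> f') f"
proof -
  obtain Z i r p where d: "i \<in> TCofib" "i \<in> hom C Y Z" "r \<in> hom C Z Y" "r \<cdot> i = Idn C Y"
    "p \<in> TFib" "p \<in> hom C Z Y'" "p \<cdot> i = h"
    using weq_fibrant_decompose[OF Y(1) h] .
  obtain f' where f': "f' \<in> hom C X Z" "p \<cdot> f' = f" using cofibrant_lift[OF X_cofibrant d(5,6) f] .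
  have "(h \<cdot> r) \<cdot> i = p \<cdot> i" using assoc[OF d(2,3) h(2)] d idn_right[OF h(2)] by simp
  from htp_extensions[OF Y(2) d(1,2) comp_hom[OF d(3) h(2)] d(6) this f'(1)]
  have "htp (h \<cdot> (r \<cdot> f')) f" using assoc[OF f'(1) d(3) h(2)] f' by simp
  then show thesis using that comp_hom[OF f'(1) d(3)] by blast
qed

end

section \<open>Homotopic arrows and the homotopy category\<close>

locale homotopy_classes = left_homotopy +
  fixes R :: "'a \<Rightarrow> 'b"
  assumes R: "\<And>Y. Y \<in> Ob C \<Longrightarrow> fibrant_replacement Y (R Y)"
begin

abbreviation "RO Y \<equiv> Cod C (R Y)"

lemma R_hom:
  assumes "Y \<in> Ob C"
  shows "R Y \<in> hom C Y (RO Y)" "R Y \<in> TCofib" "fibrant (RO Y)"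
  using R[OF assms] Cofib_Arr by (auto simp: fibrant_replacement_def hom_def)

definition htp_rel :: "'a \<Rightarrow> ('b \<times> 'b) set" where
  "htp_rel Y = {(f, g). f \<in> hom C X (RO Y) \<and> g \<in> hom C X (RO Y) \<and> htp f g}"

lemma htp_rel_idem:
  assumes "Y \<in> Ob C"
  shows "htp_rel Y O htp_rel Y = htp_rel Y"
proof -
  have "(f, h) \<in> htp_rel Y" if "(f, g) \<in> htp_rel Y" "(g, h) \<in> htp_rel Y" for f g h
    using that htp_trans[OF R_hom(3)[OF assms], of f g h] by (simp add: htp_rel_def)
  moreover have "(f, f) \<in> htp_rel Y" if "(f, g) \<in> htp_rel Y" for f g
    using that htp_refl by (auto simp: htp_rel_def)
  ultimately have "(f, g) \<in> htp_rel Y O htp_rel Y \<longleftrightarrow> (f, g) \<in> htp_rel Y" for f g by blast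
  then show ?thesis by auto
qed

lemma htp_rel_sym:
  assumes "Y \<in> Ob C"
  shows "(htp_rel Y)\<inverse> = htp_rel Y"
  using htp_sym[OF R_hom(3)[OF assms]] by (auto simp: htp_rel_def)

text \<open>The maps between the sets of homotopy classes of arrows from \<open>X\<close> to the chosen fibrant
  replacements are represented by saturated relations between the arrows themselves, with the
  homotopy relation as identity.\<close>

definition rel_cat :: "('a, 'a \<times> ('b \<times> 'b) set \<times> 'a) cat" where
  "rel_cat = \<lparr>Ob = Ob C,
     Arr = {(Y, r, Z). Y \<in> Ob C \<and> Z \<in> Ob C \<and> htp_rel Y O r = r \<and> r O htp_rel Z = r},
     Dom = (\<lambda>(Y, r, Z). Y),
     Cod = (\<lambda>(Y, r, Z). Z),
     Idn = (\<lambda>Y. (Y, htp_rel Y, Y)),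
     Comp = (\<lambda>(Z', r', W) (Y, r, Z). (Y, r O r', W))\<rparr>"

lemma rel_cat_simps:
  "Ob rel_cat = Ob C"
  "(Y, r, Z) \<in> Arr rel_cat \<longleftrightarrow> Y \<in> Ob C \<and> Z \<in> Ob C \<and> htp_rel Y O r = r \<and> r O htp_rel Z = r"
  "Dom rel_cat (Y, r, Z) = Y" "Cod rel_cat (Y, r, Z) = Z" "Idn rel_cat Y = (Y, htp_rel Y, Y)"
  "(Z', r', W) \<cdot>\<^bsub>rel_cat\<^esub> (Y, r, Z) = (Y, r O r', W)"
  by (auto simp: rel_cat_def)

lemma rel_cat_hom: "a \<in> hom rel_cat Y Z \<longleftrightarrow>
    (\<exists>r. a = (Y, r, Z) \<and> Y \<in> Ob C \<and> Z \<in> Ob C \<and> htp_rel Y O r = r \<and> r O htp_rel Z = r)"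
  by (cases a) (auto simp: hom_def rel_cat_simps)

lemma rel_cat_category: "category rel_cat"
proof
  show "Dom rel_cat a \<in> Ob rel_cat" "Cod rel_cat a \<in> Ob rel_cat" if "a \<in> Arr rel_cat" for a
    using that by (cases a; simp add: rel_cat_simps)+
  show "Idn rel_cat Y \<in> hom rel_cat Y Y" if "Y \<in> Ob rel_cat" for Y
    using that by (simp add: rel_cat_simps rel_cat_hom htp_rel_idem)
  show "b \<cdot>\<^bsub>rel_cat\<^esub> a \<in> hom rel_cat Y W" if ab: "a \<in> hom rel_cat Y Z" "b \<in> hom rel_cat Z W" for a b Y Z W
  proof -
    obtain r r' where r: "a = (Y, r, Z)" "b = (Z, r', W)" "htp_rel Y O r = r" "r' O htp_rel W = r'"
        "Y \<in> Ob C" "W \<in> Ob C"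
      using ab by (auto simp: rel_cat_hom)
    then have "htp_rel Y O (r O r') = r O r'" "(r O r') O htp_rel W = r O r'"
      using O_assoc[of "htp_rel Y" r r', symmetric] O_assoc[of r r' "htp_rel W"] by simp_all
    then show ?thesis using r by (simp add: rel_cat_hom rel_cat_simps)
  qed
  show "a \<cdot>\<^bsub>rel_cat\<^esub> Idn rel_cat Y = a" "Idn rel_cat Z \<cdot>\<^bsub>rel_cat\<^esub> a = a" if "a \<in> hom rel_cat Y Z" for a Y Z
    using that by (auto simp only: rel_cat_hom rel_cat_simps)
  show "(c \<cdot>\<^bsub>rel_cat\<^esub> b) \<cdot>\<^bsub>rel_cat\<^esub> a = c \<cdot>\<^bsub>rel_cat\<^esub> (b \<cdot>\<^bsub>rel_cat\<^esub> a)"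
    if abc: "a \<in> hom rel_cat U V" "b \<in> hom rel_cat V W" "c \<in> hom rel_cat W Y" for a b c U V W Y
  proof -
    obtain r r' r'' where "a = (U, r, V)" "b = (V, r', W)" "c = (W, r'', Y)"
      using abc unfolding rel_cat_hom by blast
    then show ?thesis by (simp only: rel_cat_simps O_assoc)
  qed
qed

text \<open>The graph, on arrows instead of homotopy classes, of the map that \<open>g\<close> induces through an
  extension over the fibrant replacements.\<close>

definition step_rel :: "'b \<Rightarrow> ('b \<times> 'b) set" where
  "step_rel g = {(f, f'). f \<in> hom C X (RO (Dom C g)) \<and> f' \<in> hom C X (RO (Cod C g)) \<and>
     (\<exists>h \<in> hom C (RO (Dom C g)) (RO (Cod C g)). h \<cdot> R (Dom C g) = R (Cod C g) \<cdot> g \<and> htp (h \<cdot> f) f')}"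

lemma extension_exists:
  assumes "g \<in> hom C Y Z"
  obtains h where "h \<in> hom C (RO Y) (RO Z)" "h \<cdot> R Y = R Z \<cdot> g"
proof -
  have YZ: "Y \<in> Ob C" "Z \<in> Ob C" using assms dom_in cod_in by (auto simp: hom_def)
  show thesis
    using fibrant_extend[OF R_hom(3)[OF YZ(2)] R_hom(2,1)[OF YZ(1)] comp_hom[OF assms R_hom(1)[OF YZ(2)]]] that .
qed

text \<open>Extensions are unique up to homotopy, so the existential in the definition may be replaced by
  any one extension.\<close>

lemma step_rel_iff:
  assumes g: "g \<in> hom C Y Z" and h: "h \<in> hom C (RO Y) (RO Z)" "h \<cdot> R Y = R Z \<cdot> g"
  shows "(f, f') \<in> step_rel g \<longleftrightarrow> f \<in> hom C X (RO Y) \<and> f' \<in> hom C X (RO Z) \<and> htp (h \<cdot> f) f'"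
proof -
  have dc: "Dom C g = Y" "Cod C g = Z" and YZ: "Y \<in> Ob C" "Z \<in> Ob C"
    using g dom_in cod_in by (auto simp: hom_def)
  have "htp (h \<cdot> f) f'"
    if "f \<in> hom C X (RO Y)" "h' \<in> hom C (RO Y) (RO Z)" "h' \<cdot> R Y = R Z \<cdot> g" "htp (h' \<cdot> f) f'" for h'
  proof -
    have "htp (h \<cdot> f) (h' \<cdot> f)"
      using htp_extensions[OF R_hom(3)[OF YZ(2)] R_hom(2,1)[OF YZ(1)] h(1) that(2) _ that(1)] h(2) that(3) by simp
    then show ?thesis using htp_trans[OF R_hom(3)[OF YZ(2)] comp_hom[OF that(1) h(1)]] that(4) by blast
  qed
  then show ?thesis using h unfolding step_rel_def dc by blast
qed

lemma step_rel_saturated: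
  assumes g: "g \<in> hom C Y Z"
  shows "htp_rel Y O step_rel g = step_rel g" "step_rel g O htp_rel Z = step_rel g"
proof -
  have YZ: "Y \<in> Ob C" "Z \<in> Ob C" using g dom_in cod_in by (auto simp: hom_def)
  obtain h where h: "h \<in> hom C (RO Y) (RO Z)" "h \<cdot> R Y = R Z \<cdot> g" using extension_exists[OF g] .
  note trans = htp_trans[OF R_hom(3)[OF YZ(2)]] and iff = step_rel_iff[OF g h]
  have "(f, f') \<in> step_rel g" if "(f, e) \<in> htp_rel Y" "(e, f') \<in> step_rel g" for f e f'
    using that trans[OF comp_hom[OF _ h(1)] htp_comp[OF _ _ h(1)], of f e f'] by (auto simp: iff htp_rel_def)
  moreover have "(f, f) \<in> htp_rel Y" if "(f, f') \<in> step_rel g" for f f'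
    using that htp_refl by (auto simp: iff htp_rel_def)
  ultimately have "(f, f') \<in> htp_rel Y O step_rel g \<longleftrightarrow> (f, f') \<in> step_rel g" for f f' by blast
  then show "htp_rel Y O step_rel g = step_rel g" by auto
  have "(f, f') \<in> step_rel g" if "(f, e) \<in> step_rel g" "(e, f') \<in> htp_rel Z" for f e f'
    using that trans[OF comp_hom[OF _ h(1)], of f e f'] by (auto simp: iff htp_rel_def)
  moreover have "(f', f') \<in> htp_rel Z" if "(f, f') \<in> step_rel g" for f f'
    using that htp_refl by (auto simp: iff htp_rel_def)
  ultimately have "(f, f') \<in> step_rel g O htp_rel Z \<longleftrightarrow> (f, f') \<in> step_rel g" for f f' by blast
  then show "step_rel g O htp_rel Z = step_rel g" by auto
qed

lemma step_rel_idn: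
  assumes "Y \<in> Ob C"
  shows "step_rel (Idn C Y) = htp_rel Y"
proof -
  have i: "Idn C (RO Y) \<in> hom C (RO Y) (RO Y)" "Idn C (RO Y) \<cdot> R Y = R Y \<cdot> Idn C Y"
    using idn_hom R_hom[OF assms] idn_left idn_right by (auto simp: fibrant_def)
  show ?thesis
    using step_rel_iff[OF idn_hom[OF assms] i] idn_left by (auto simp: htp_rel_def)
qed

lemma step_rel_comp:
  assumes g: "g \<in> hom C Y Z" and g': "g' \<in> hom C Z W"
  shows "step_rel (g' \<cdot> g) = step_rel g O step_rel g'"
proof -
  have W: "W \<in> Ob C" and Z: "Z \<in> Ob C" and Y: "Y \<in> Ob C"
    using g g' dom_in cod_in by (auto simp: hom_def)
  obtain h where h: "h \<in> hom C (RO Y) (RO Z)" "h \<cdot> R Y = R Z \<cdot> g" using extension_exists[OF g] .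
  obtain h' where h': "h' \<in> hom C (RO Z) (RO W)" "h' \<cdot> R Z = R W \<cdot> g'" using extension_exists[OF g'] .
  have hh: "h' \<cdot> h \<in> hom C (RO Y) (RO W)" "(h' \<cdot> h) \<cdot> R Y = R W \<cdot> (g' \<cdot> g)"
    using h h' comp_hom assoc[OF R_hom(1)[OF Y] h(1) h'(1)] assoc[OF g R_hom(1)[OF Z] h'(1)]
      assoc[OF g g' R_hom(1)[OF W]] by auto
  note iff = step_rel_iff[OF g h] step_rel_iff[OF g' h'] step_rel_iff[OF comp_hom[OF g g'] hh]
  have "htp (h' \<cdot> (h \<cdot> f)) e"
    if "f \<in> hom C X (RO Y)" "htp (h \<cdot> f) f'" "htp (h' \<cdot> f') e" for f f' e
    using that htp_trans[OF R_hom(3)[OF W] comp_hom[OF comp_hom[OF that(1) h(1)] h'(1)]]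
      htp_comp[OF that(2) comp_hom[OF that(1) h(1)] h'(1)] by blast
  moreover have "htp (h \<cdot> f) (h \<cdot> f) \<and> h \<cdot> f \<in> hom C X (RO Z)" if "f \<in> hom C X (RO Y)" for f
    using htp_refl comp_hom[OF that h(1)] by blast
  ultimately have "(f, e) \<in> step_rel (g' \<cdot> g) \<longleftrightarrow> (\<exists>f'. (f, f') \<in> step_rel g \<and> (f', e) \<in> step_rel g')" for f e
    unfolding iff by (cases "f \<in> hom C X (RO Y)") (auto simp: assoc[OF _ h(1) h'(1)] intro!: exI[of _ "h \<cdot> f"])
  then show ?thesis by auto
qed

lemma step_rel_inverse:
  assumes w: "w \<in> Weq" "w \<in> hom C Y Z"
  shows "step_rel w O (step_rel w)\<inverse> = htp_rel Y" "(step_rel w)\<inverse> O step_rel w = htp_rel Z"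
proof -
  have Z: "Z \<in> Ob C" and Y: "Y \<in> Ob C" using w dom_in cod_in by (auto simp: hom_def)
  obtain h where h: "h \<in> hom C (RO Y) (RO Z)" "h \<cdot> R Y = R Z \<cdot> w" using extension_exists[OF w(2)] .
  have "R Z \<cdot> w \<in> Weq" using Weq_comp(1)[OF w(2) R_hom(1)[OF Z]] w(1) R_hom(2)[OF Z] by blast
  then have hW: "h \<in> Weq" using Weq_comp(2)[OF R_hom(1)[OF Y] h(1)] R_hom(2)[OF Y] h(2) by simp
  note iff = step_rel_iff[OF w(2) h] and FY = R_hom(3)[OF Y] and FZ = R_hom(3)[OF Z]
  have hc: "h \<cdot> f \<in> hom C X (RO Z)" if "f \<in> hom C X (RO Y)" for f using comp_hom[OF that h(1)] .
  have "htp f g" if "f \<in> hom C X (RO Y)" "g \<in> hom C X (RO Y)" "htp (h \<cdot> f) e" "htp (h \<cdot> g) e" for f g e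
    using weq_reflects_htp[OF FY hW h(1) that(1,2)] htp_trans[OF FZ hc[OF that(1)] that(3)]
      htp_sym[OF FZ hc[OF that(2)] that(4)] by blast
  moreover have "htp (h \<cdot> f) (h \<cdot> g) \<and> htp (h \<cdot> g) (h \<cdot> g)"
    if "f \<in> hom C X (RO Y)" "g \<in> hom C X (RO Y)" "htp f g" for f g
    using htp_comp[OF that(3,1) h(1)] htp_refl[OF hc[OF that(2)]] by blast
  ultimately have "(f, g) \<in> step_rel w O (step_rel w)\<inverse> \<longleftrightarrow> (f, g) \<in> htp_rel Y" for f g
    using hc unfolding relcomp_unfold converse_iff iff htp_rel_def by blast
  then show "step_rel w O (step_rel w)\<inverse> = htp_rel Y" by auto
  have "htp f g" if "e \<in> hom C X (RO Y)" "htp (h \<cdot> e) f" "htp (h \<cdot> e) g" for f g e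
    using htp_trans[OF FZ _ htp_sym[OF FZ hc[OF that(1)] that(2)] that(3)] htp_hom[OF that(2) hc[OF that(1)]] .
  moreover have "\<exists>e. e \<in> hom C X (RO Y) \<and> htp (h \<cdot> e) f \<and> htp (h \<cdot> e) g"
    if "f \<in> hom C X (RO Z)" "htp f g" for f g
    using weq_lifts_up_to_htp[OF FY FZ hW h(1) that(1)] htp_trans[OF FZ hc _ that(2)] by metis
  ultimately have "(f, g) \<in> (step_rel w)\<inverse> O step_rel w \<longleftrightarrow> (f, g) \<in> htp_rel Z" for f g
    unfolding relcomp_unfold converse_iff iff htp_rel_def by blast
  then show "(step_rel w)\<inverse> O step_rel w = htp_rel Z" by auto
qed

definition classes_functor :: "('a, 'b, 'a, 'a \<times> ('b \<times> 'b) set \<times> 'a) func" where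
  "classes_functor = \<lparr>fobj = \<lambda>Y \<in> Ob C. Y, farr = \<lambda>g \<in> Arr C. (Dom C g, step_rel g, Cod C g)\<rparr>"

lemma classes_functor_functor: "is_functor C rel_cat classes_functor"
proof -
  have "(Dom C g, step_rel g, Cod C g) \<in> Arr rel_cat" if "g \<in> Arr C" for g
    using that step_rel_saturated[of g] dom_in cod_in by (auto simp: rel_cat_simps hom_def)
  moreover have "step_rel (g' \<cdot> g) = step_rel g O step_rel g'"
    if "g \<in> Arr C" "g' \<in> Arr C" "Cod C g = Dom C g'" for g g'
    using that step_rel_comp[of g _ _ g'] by (auto simp: hom_def)
  ultimately show ?thesis
    using category_axioms rel_cat_category dom_in cod_in
    by (auto simp: is_functor_def classes_functor_def rel_cat_simps comp_arr idn_arr step_rel_idn)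
qed

lemma classes_functor_inverts:
  assumes "w \<in> Weq"
  shows "is_iso rel_cat (farr classes_functor w)"
proof -
  have wA: "w \<in> Arr C" using assms Weq_Arr by blast
  define Y Z where "Y = Dom C w" and "Z = Cod C w"
  have w: "w \<in> hom C Y Z" using wA by (simp add: hom_def Y_def Z_def)
  have YZ: "Y \<in> Ob C" "Z \<in> Ob C" using wA dom_in cod_in by (auto simp: Y_def Z_def)
  have "htp_rel Z O (step_rel w)\<inverse> = (step_rel w)\<inverse>" "(step_rel w)\<inverse> O htp_rel Y = (step_rel w)\<inverse>"
    using step_rel_saturated[OF w] htp_rel_sym[OF YZ(1)] htp_rel_sym[OF YZ(2)] by (metis converse_relcomp)+
  then have "(Z, (step_rel w)\<inverse>, Y) \<in> hom rel_cat Z Y" using YZ by (simp add: rel_cat_hom)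
  moreover have "farr classes_functor w = (Y, step_rel w, Z)" using wA by (simp add: classes_functor_def Y_def Z_def)
  moreover have "(Y, step_rel w, Z) \<in> Arr rel_cat"
    using step_rel_saturated[OF w] YZ by (simp add: rel_cat_simps)
  ultimately show ?thesis
    using step_rel_inverse[OF assms w] unfolding is_iso_def
    by (intro conjI bexI[of _ "(Z, (step_rel w)\<inverse>, Y)"]) (auto simp: rel_cat_simps)
qed

text \<open>The functor of homotopy classes factors through the localization, so it cannot separate
  arrows that the localization identifies. Its value at \<open>f\<close>, applied to the class of \<open>R X\<close>, is the
  class of \<open>R Y \<cdot> f\<close>, as in the lemma of Yoneda.\<close>

lemma loc_eq_imp_htp:
  assumes f: "f \<in> hom C X Y" and g: "g \<in> hom C X Y" and eq: "loc f = loc g"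
  shows "htp (R Y \<cdot> f) (R Y \<cdot> g)"
proof -
  obtain G where G: "comp_functor C G (loc_functor C Weq) = classes_functor"
    using localization_universal[OF Weq_Arr classes_functor_functor] classes_functor_inverts by blast
  have "farr classes_functor a = farr G (loc a)" if "a \<in> Arr C" for a
    using that by (simp add: G[symmetric] comp_functor_def compose_def)
  from this[of f] this[of g] have "farr classes_functor f = farr classes_functor g"
    using homD[OF f] homD[OF g] eq by simp
  then have "step_rel f = step_rel g" using homD[OF f] homD[OF g] by (simp add: classes_functor_def)
  moreover have X: "X \<in> Ob C" using X_cofibrant by (simp add: cofibrant_def)
  obtain h where h: "h \<in> hom C (RO X) (RO Y)" "h \<cdot> R X = R Y \<cdot> f" using extension_exists[OF f] .
  obtain h' where h': "h' \<in> hom C (RO X) (RO Y)" "h' \<cdot> R X = R Y \<cdot> g" using extension_exists[OF g] .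
  have RX: "R X \<in> hom C X (RO X)" using R_hom[OF X] by blast
  have "(R X, R Y \<cdot> g) \<in> step_rel g"
    using step_rel_iff[OF g h'] RX h'(2) comp_hom[OF RX h'(1)] htp_refl by auto
  ultimately show ?thesis using step_rel_iff[OF f h] h(2) by auto
qed

end

context model_structure
begin

text \<open>The homotopy is spelled out as a diagram of fixed finite shape, so that a family of homotopies
  can be assembled componentwise.\<close>

theorem loc_eq_imp_homotopic:
  assumes products: "has_finite_products C" and coproducts: "has_finite_coproducts C"
    and X: "cofibrant X" and f: "f \<in> hom C X Y" and g: "g \<in> hom C X Y" and eq: "loc f = loc g"
  obtains j Y' T k l s H where "j \<in> Weq" "j \<in> hom C Y Y'" "k \<in> hom C X T" "l \<in> hom C X T"
    "s \<in> Weq" "s \<in> hom C T X" "s \<cdot> k = Idn C X" "s \<cdot> l = Idn C X"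
    "H \<in> hom C T Y'" "H \<cdot> k = j \<cdot> f" "H \<cdot> l = j \<cdot> g"
proof -
  have XY: "X \<in> Ob C" "Y \<in> Ob C" using f dom_in cod_in by (auto simp: hom_def)
  obtain T k l s where cyl: "cylinder X T k l s" using cylinder_exists[OF coproducts XY(1)] .
  define R where "R Y = (SOME j. fibrant_replacement Y j)" for Y
  interpret homotopy_classes C Cofib Fib Weq X T k l s R
  proof
    show "cofibrant X" "cylinder X T k l s" by fact+
    show "\<exists>P u v t. path_object Y P u v t" if "fibrant Y" for Y
    proof -
      have "Y \<in> Ob C" using that by (simp add: fibrant_def)
      from path_object_exists[OF products this] obtain P u v t where "path_object Y P u v t" .
      then show ?thesis by blast
    qed
    show "fibrant_replacement Y (R Y)" if Y: "Y \<in> Ob C" for Y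
    proof -
      obtain j where "fibrant_replacement Y j" using fibrant_replacement_exists[OF products Y] .
      then show ?thesis unfolding R_def by (rule someI)
    qed
  qed
  note RY = R_hom[OF XY(2)]
  obtain H where "H \<in> hom C T (RO Y)" "H \<cdot> k = R Y \<cdot> f" "H \<cdot> l = R Y \<cdot> g"
    using htpE[OF loc_eq_imp_htp[OF f g eq] comp_hom[OF f RY(1)]] .
  then show thesis using that[of "R Y" "RO Y" k T l s H] RY cyl unfolding cylinder_def by blast
qed

text \<open>In the homotopy category \<open>s\<close> is invertible, which identifies \<open>k\<close> with \<open>l\<close> and hence the two
  ends of \<open>H\<close>.\<close>

lemma homotopic_imp_loc_eq:
  assumes f: "f \<in> hom C X Y" and g: "g \<in> hom C X Y" and j: "j \<in> Weq" "j \<in> hom C Y Y'"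
    and k: "k \<in> hom C X T" and l: "l \<in> hom C X T" and s: "s \<in> Weq" "s \<in> hom C T X"
    and eq: "s \<cdot> k = s \<cdot> l" and H: "H \<in> hom C T Y'" "H \<cdot> k = j \<cdot> f" "H \<cdot> l = j \<cdot> g"
  shows "loc f = loc g"
proof -
  interpret L: category L by (rule L_cat)
  have "loc s \<cdot>\<^bsub>L\<^esub> loc k = loc s \<cdot>\<^bsub>L\<^esub> loc l"
    using loc_comp_arr[OF k s(2)] loc_comp_arr[OF l s(2)] eq by simp
  then have "loc k = loc l"
    by (rule L.iso_cancel_left[OF loc_iso[OF s(1)] loc_hom[OF s(2)] loc_hom[OF k] loc_hom[OF l]])
  then have "loc j \<cdot>\<^bsub>L\<^esub> loc f = loc j \<cdot>\<^bsub>L\<^esub> loc g"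
    using loc_comp_arr[OF k H(1)] loc_comp_arr[OF l H(1)] loc_comp_arr[OF f j(2)] loc_comp_arr[OF g j(2)] H
    by simp
  then show ?thesis
    by (rule L.iso_cancel_left[OF loc_iso[OF j(1)] loc_hom[OF j(2)] loc_hom[OF f] loc_hom[OF g]])
qed

end

section \<open>Powers of a model structure\<close>

lemma power_hom_component:
  assumes "f \<in> hom (power_cat I C) X Y" "i \<in> I"
  shows "f i \<in> hom C (X i) (Y i)"
  using assms by (auto simp: hom_def power_cat_def)

lemma power_homI:
  assumes "X \<in> I \<rightarrow>\<^sub>E Ob C" "Y \<in> I \<rightarrow>\<^sub>E Ob C" "f \<in> extensional I" "\<And>i. i \<in> I \<Longrightarrow> f i \<in> hom C (X i) (Y i)"
  shows "f \<in> hom (power_cat I C) X Y"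
  using assms by (simp add: hom_power_iff PiE_iff)

lemma power_comp_apply: "i \<in> I \<Longrightarrow> (g \<cdot>\<^bsub>power_cat I C\<^esub> f) i = g i \<cdot>\<^bsub>C\<^esub> f i"
  by (simp add: power_cat_def)

lemma power_idn_apply: "i \<in> I \<Longrightarrow> Idn (power_cat I C) X i = Idn C (X i)"
  by (simp add: power_cat_def)

lemma (in category) power_arr_eqI:
  assumes "f \<in> hom (power_cat I C) X Y" "g \<in> hom (power_cat I C) X Y" "\<And>i. i \<in> I \<Longrightarrow> f i = g i"
  shows "f = g"
  using assms by (intro extensionalityI[of f I g]) (auto simp: hom_def power_cat_def PiE_iff)

lemma (in category) has_lifting_power:
  assumes i: "i \<in> I \<rightarrow>\<^sub>E Arr C" and p: "p \<in> I \<rightarrow>\<^sub>E Arr C"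
    and lift: "\<And>x. x \<in> I \<Longrightarrow> has_lifting C (i x) (p x)"
  shows "has_lifting (power_cat I C) i p"
  unfolding has_lifting_def
proof (intro ballI impI)
  let ?P = "power_cat I C"
  interpret P: category ?P by (rule category_power[OF category_axioms])
  fix a b
  assume a: "a \<in> hom ?P (Dom ?P i) (Dom ?P p)" and b: "b \<in> hom ?P (Cod ?P i) (Cod ?P p)"
    and eq: "p \<cdot>\<^bsub>?P\<^esub> a = b \<cdot>\<^bsub>?P\<^esub> i"
  have "\<exists>h. h \<in> hom C (Cod C (i x)) (Dom C (p x)) \<and> h \<cdot> i x = a x \<and> p x \<cdot> h = b x" if x: "x \<in> I" for x
  proof -
    have "a x \<in> hom C (Dom C (i x)) (Dom C (p x))" "b x \<in> hom C (Cod C (i x)) (Cod C (p x))"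
      using power_hom_component[OF a x] power_hom_component[OF b x] x by (auto simp: power_cat_def)
    moreover have "p x \<cdot> a x = b x \<cdot> i x" using fun_cong[OF eq, of x] x by (simp add: power_comp_apply)
    ultimately show ?thesis using lift[OF x] unfolding has_lifting_def by blast
  qed
  then obtain h where h: "\<And>x. x \<in> I \<Longrightarrow> h x \<in> hom C (Cod C (i x)) (Dom C (p x))"
    "\<And>x. x \<in> I \<Longrightarrow> h x \<cdot> i x = a x" "\<And>x. x \<in> I \<Longrightarrow> p x \<cdot> h x = b x"
    by metis
  define h' where "h' = restrict h I"
  have ih: "i \<in> hom ?P (Dom ?P i) (Cod ?P i)" and ph: "p \<in> hom ?P (Dom ?P p) (Cod ?P p)"
    using i p by (auto simp: hom_def power_cat_def)
  have h': "h' \<in> hom ?P (Cod ?P i) (Dom ?P p)"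
    using ih ph P.dom_in P.cod_in h(1)
    by (intro power_homI) (auto simp: hom_def h'_def power_cat_def)
  have "h' \<cdot>\<^bsub>?P\<^esub> i = a"
    by (rule power_arr_eqI[OF P.comp_hom[OF ih h'] a]) (simp add: h power_comp_apply h'_def)
  moreover have "p \<cdot>\<^bsub>?P\<^esub> h' = b"
    by (rule power_arr_eqI[OF P.comp_hom[OF h' ph] b]) (simp add: h power_comp_apply h'_def)
  ultimately show "\<exists>h \<in> hom ?P (Cod ?P i) (Dom ?P p). h \<cdot>\<^bsub>?P\<^esub> i = a \<and> p \<cdot>\<^bsub>?P\<^esub> h = b" using h' by blast
qed

lemma wide_power:
  assumes "wide_subcategory C S"
  shows "wide_subcategory (power_cat I C) (power_arrows I S)"
  unfolding wide_subcategory_def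
proof (intro conjI ballI impI)
  let ?P = "power_cat I C"
  note w = assms[unfolded wide_subcategory_def]
  show "power_arrows I S \<subseteq> Arr ?P" using w by (auto simp: power_arrows_def power_cat_def PiE_iff)
  show "Idn ?P X \<in> power_arrows I S" if "X \<in> Ob ?P" for X
    using that w by (auto simp: power_arrows_def power_cat_def PiE_iff)
  show "g \<cdot>\<^bsub>?P\<^esub> f \<in> power_arrows I S"
    if "f \<in> power_arrows I S" "g \<in> power_arrows I S" "Cod ?P f = Dom ?P g" for f g
  proof -
    have "Cod C (f i) = Dom C (g i)" if "i \<in> I" for i
      using fun_cong[OF \<open>Cod ?P f = Dom ?P g\<close>, of i] that by (simp add: power_cat_def)
    then show ?thesis using that(1,2) w by (auto simp: power_arrows_def power_cat_def PiE_iff)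
  qed
qed

lemma retract_closed_power:
  assumes "retract_closed C S"
  shows "retract_closed (power_cat I C) (power_arrows I S)"
  unfolding retract_closed_def
proof (intro ballI impI)
  let ?P = "power_cat I C"
  fix f g assume f: "f \<in> Arr ?P" and g: "g \<in> power_arrows I S" and r: "is_retract ?P f g"
  have "f x \<in> S" if x: "x \<in> I" for x
  proof -
    have dc: "Dom ?P f x = Dom C (f x)" "Cod ?P f x = Cod C (f x)"
      "Dom ?P g x = Dom C (g x)" "Cod ?P g x = Cod C (g x)"
      using x by (auto simp: power_cat_def)
    obtain i r j s where h: "i \<in> hom ?P (Dom ?P f) (Dom ?P g)" "r \<in> hom ?P (Dom ?P g) (Dom ?P f)"
      "j \<in> hom ?P (Cod ?P f) (Cod ?P g)" "s \<in> hom ?P (Cod ?P g) (Cod ?P f)"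
      and e: "g \<cdot>\<^bsub>?P\<^esub> i = j \<cdot>\<^bsub>?P\<^esub> f" "f \<cdot>\<^bsub>?P\<^esub> r = s \<cdot>\<^bsub>?P\<^esub> g"
        "r \<cdot>\<^bsub>?P\<^esub> i = Idn ?P (Dom ?P f)" "s \<cdot>\<^bsub>?P\<^esub> j = Idn ?P (Cod ?P f)"
      using r unfolding is_retract_def by blast
    have "is_retract C (f x) (g x)"
      unfolding is_retract_def
      using h[THEN power_hom_component[OF _ x], unfolded dc]
        e[THEN fun_cong, of x, unfolded power_comp_apply[OF x] power_idn_apply[OF x] dc] by blast
    then show ?thesis
      using assms f g x by (auto simp: retract_closed_def power_cat_def power_arrows_def PiE_iff)
  qed
  then show "f \<in> power_arrows I S" using f by (auto simp: power_cat_def power_arrows_def PiE_iff)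
qed

lemma two_of_three_power:
  assumes "two_of_three C S"
  shows "two_of_three (power_cat I C) (power_arrows I S)"
  unfolding two_of_three_def
proof (intro ballI impI)
  let ?P = "power_cat I C"
  fix f g assume f: "f \<in> Arr ?P" and g: "g \<in> Arr ?P" and fg: "Cod ?P f = Dom ?P g"
  have "Cod C (f i) = Dom C (g i)" "f i \<in> Arr C" "g i \<in> Arr C" if "i \<in> I" for i
    using fun_cong[OF fg, of i] that f g by (auto simp: power_cat_def)
  then have comp: "(f i \<in> S \<and> g i \<in> S \<longrightarrow> g i \<cdot>\<^bsub>C\<^esub> f i \<in> S) \<and> (f i \<in> S \<and> g i \<cdot>\<^bsub>C\<^esub> f i \<in> S \<longrightarrow> g i \<in> S) \<and>
      (g i \<in> S \<and> g i \<cdot>\<^bsub>C\<^esub> f i \<in> S \<longrightarrow> f i \<in> S)" if "i \<in> I" for i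
    using assms that unfolding two_of_three_def by blast
  have mem: "h \<in> power_arrows I S \<longleftrightarrow> (\<forall>i\<in>I. h i \<in> S)" if "h \<in> extensional I" for h
    using that by (auto simp: power_arrows_def PiE_iff)
  have ext: "f \<in> extensional I" "g \<in> extensional I" "g \<cdot>\<^bsub>?P\<^esub> f \<in> extensional I"
    using f g by (auto simp: power_cat_def PiE_iff)
  have gf: "g \<cdot>\<^bsub>?P\<^esub> f \<in> power_arrows I S \<longleftrightarrow> (\<forall>i\<in>I. g i \<cdot>\<^bsub>C\<^esub> f i \<in> S)"
    using mem[OF ext(3)] by (simp add: power_comp_apply)
  show "(f \<in> power_arrows I S \<and> g \<in> power_arrows I S \<longrightarrow> g \<cdot>\<^bsub>?P\<^esub> f \<in> power_arrows I S) \<and>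
      (f \<in> power_arrows I S \<and> g \<cdot>\<^bsub>?P\<^esub> f \<in> power_arrows I S \<longrightarrow> g \<in> power_arrows I S) \<and>
      (g \<in> power_arrows I S \<and> g \<cdot>\<^bsub>?P\<^esub> f \<in> power_arrows I S \<longrightarrow> f \<in> power_arrows I S)"
    unfolding gf mem[OF ext(1)] mem[OF ext(2)] using comp by blast
qed

lemma factorization_power:
  assumes S: "S \<subseteq> Arr C" and fact: "\<And>f. f \<in> Arr C \<Longrightarrow> \<exists>i \<in> S. \<exists>p \<in> S'. Cod C i = Dom C p \<and> f = p \<cdot>\<^bsub>C\<^esub> i"
    and f: "f \<in> Arr (power_cat I C)"
  shows "\<exists>i \<in> power_arrows I S. \<exists>p \<in> power_arrows I S'.
    Cod (power_cat I C) i = Dom (power_cat I C) p \<and> f = p \<cdot>\<^bsub>power_cat I C\<^esub> i"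
proof -
  have "\<exists>i p. i \<in> S \<and> p \<in> S' \<and> Cod C i = Dom C p \<and> f x = p \<cdot>\<^bsub>C\<^esub> i" if "x \<in> I" for x
    using fact[of "f x"] f that by (auto simp: power_cat_def)
  then obtain i p where "\<And>x. x \<in> I \<Longrightarrow> i x \<in> S \<and> p x \<in> S' \<and> Cod C (i x) = Dom C (p x) \<and> f x = p x \<cdot>\<^bsub>C\<^esub> i x"
    by metis
  then show ?thesis
    using f by (intro bexI[of _ "restrict i I"] bexI[of _ "restrict p I"])
      (auto simp: power_arrows_def power_cat_def PiE_iff extensional_def)
qed

lemma power_arrows_Int: "power_arrows I S \<inter> power_arrows I S' = power_arrows I (S \<inter> S')"
  by (auto simp: power_arrows_def PiE_iff)

text \<open>Lifts and factorizations in the power are chosen one component at a time, so the power is a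
  model structure and \<open>loc_arrow_representable\<close> applies to it.\<close>

locale power_model = model_structure +
  fixes I :: "'i set"
begin

abbreviation "P \<equiv> power_cat I C"

sublocale P: model_structure P "power_arrows I Cofib" "power_arrows I Fib" "power_arrows I Weq"
proof (intro model_structure.intro model_structure_axioms.intro)
  have arr: "h \<in> I \<rightarrow>\<^sub>E Arr C" if "h \<in> power_arrows I S" "S \<subseteq> Arr C" for h S
    using that by (auto simp: power_arrows_def PiE_iff)
  show "category P" by (rule category_power[OF category_axioms])
  show "wide_subcategory P (power_arrows I Cofib)" "wide_subcategory P (power_arrows I Fib)"
    "wide_subcategory P (power_arrows I Weq)" "two_of_three P (power_arrows I Weq)"
    "retract_closed P (power_arrows I Cofib)" "retract_closed P (power_arrows I Fib)"
    "retract_closed P (power_arrows I Weq)"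
    using wide CM1 CM2 wide_power two_of_three_power retract_closed_power by blast+
  show "has_lifting P i p"
    if "i \<in> power_arrows I Cofib" "p \<in> power_arrows I Fib \<inter> power_arrows I Weq" for i p
    using that arr[OF that(1) Cofib_Arr] arr[of p Fib] Fib_Arr CM3(1)
    by (intro has_lifting_power) (auto simp: power_arrows_def PiE_iff)
  show "has_lifting P i p"
    if "i \<in> power_arrows I Cofib \<inter> power_arrows I Weq" "p \<in> power_arrows I Fib" for i p
    using that arr[of i Cofib] arr[OF that(2) Fib_Arr] Cofib_Arr CM3(2)
    by (intro has_lifting_power) (auto simp: power_arrows_def PiE_iff)
  show "\<exists>i\<in>power_arrows I Cofib. \<exists>p\<in>power_arrows I Fib \<inter> power_arrows I Weq. Cod P i = Dom P p \<and> f = p \<cdot>\<^bsub>P\<^esub> i"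
    if "f \<in> Arr P" for f
    unfolding power_arrows_Int by (rule factorization_power[OF Cofib_Arr CM4(1) that])
  show "\<exists>i\<in>power_arrows I Cofib \<inter> power_arrows I Weq. \<exists>p\<in>power_arrows I Fib. Cod P i = Dom P p \<and> f = p \<cdot>\<^bsub>P\<^esub> i"
    if "f \<in> Arr P" for f
    unfolding power_arrows_Int using factorization_power[OF _ CM4(2) that] Cofib_Arr by blast
qed

lemma power_cofibrant:
  assumes X: "X \<in> I \<rightarrow>\<^sub>E Ob C" and cof: "\<And>i. i \<in> I \<Longrightarrow> cofibrant (X i)"
  shows "P.cofibrant X"
  unfolding P.cofibrant_def
proof (intro conjI ballI)
  show "X \<in> Ob P" using X by (simp add: power_cat_def)
  fix p b assume p: "p \<in> power_arrows I Fib \<inter> power_arrows I Weq" and b: "b \<in> hom P X (Cod P p)"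
  have pA: "p \<in> Arr P" using p P.Fib_Arr by blast
  then have ph: "p \<in> hom P (Dom P p) (Cod P p)" by (simp add: hom_def)
  have "\<exists>h. h \<in> hom C (X i) (Dom C (p i)) \<and> p i \<cdot> h = b i" if i: "i \<in> I" for i
  proof -
    have "p i \<in> TFib" "b i \<in> hom C (X i) (Cod C (p i))"
      using power_hom_component[OF b i] p i by (auto simp: power_arrows_def PiE_iff power_cat_def)
    then show ?thesis using cof[OF i] unfolding cofibrant_def by blast
  qed
  then obtain h where h: "\<And>i. i \<in> I \<Longrightarrow> h i \<in> hom C (X i) (Dom C (p i)) \<and> p i \<cdot> h i = b i" by metis
  have h': "restrict h I \<in> hom P X (Dom P p)"
    using X P.dom_in[OF pA] h by (intro power_homI) (auto simp: power_cat_def)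
  have "p \<cdot>\<^bsub>P\<^esub> restrict h I = b"
    using h by (intro power_arr_eqI[OF P.comp_hom[OF h' ph] b]) (simp add: power_comp_apply)
  then show "\<exists>h \<in> hom P X (Dom P p). p \<cdot>\<^bsub>P\<^esub> h = b" using h' by blast
qed

lemma power_fibrant:
  assumes Y: "Y \<in> I \<rightarrow>\<^sub>E Ob C" and fib: "\<And>i. i \<in> I \<Longrightarrow> fibrant (Y i)"
  shows "P.fibrant Y"
  unfolding P.fibrant_def
proof (intro conjI ballI)
  show "Y \<in> Ob P" using Y by (simp add: power_cat_def)
  fix c a assume c: "c \<in> power_arrows I Cofib \<inter> power_arrows I Weq" and a: "a \<in> hom P (Dom P c) Y"
  have cA: "c \<in> Arr P" using c P.Cofib_Arr by blast
  then have ch: "c \<in> hom P (Dom P c) (Cod P c)" by (simp add: hom_def)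
  have "\<exists>h. h \<in> hom C (Cod C (c i)) (Y i) \<and> h \<cdot> c i = a i" if i: "i \<in> I" for i
  proof -
    have "c i \<in> TCofib" "a i \<in> hom C (Dom C (c i)) (Y i)"
      using power_hom_component[OF a i] c i by (auto simp: power_arrows_def PiE_iff power_cat_def)
    then show ?thesis using fib[OF i] unfolding fibrant_def by blast
  qed
  then obtain h where h: "\<And>i. i \<in> I \<Longrightarrow> h i \<in> hom C (Cod C (c i)) (Y i) \<and> h i \<cdot> c i = a i" by metis
  have h': "restrict h I \<in> hom P (Cod P c) Y"
    using Y P.cod_in[OF cA] h by (intro power_homI) (auto simp: power_cat_def)
  have "restrict h I \<cdot>\<^bsub>P\<^esub> c = a"
    using h by (intro power_arr_eqI[OF P.comp_hom[OF ch h'] a]) (simp add: power_comp_apply)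
  then show "\<exists>h \<in> hom P (Cod P c) Y. h \<cdot>\<^bsub>P\<^esub> c = a" using h' by blast
qed

end

section \<open>The comparison functor\<close>

lemma cat_isoI:
  assumes F: "is_functor C D F" and ob: "bij_betw (fobj F) (Ob C) (Ob D)"
    and arr: "bij_betw (farr F) (Arr C) (Arr D)"
  shows "is_cat_iso C D F"
proof -
  interpret C: category C using F by (simp add: is_functor_def)
  interpret D: category D using F by (simp add: is_functor_def)
  define o' where "o' = inv_into (Ob C) (fobj F)"
  define a' where "a' = inv_into (Arr C) (farr F)"
  have o1: "o' (fobj F X) = X" if "X \<in> Ob C" for X
    using that ob by (simp add: o'_def bij_betw_inv_into_left)
  have o2: "fobj F (o' Y) = Y" "o' Y \<in> Ob C" if "Y \<in> Ob D" for Y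
    using that ob bij_betw_apply[OF bij_betw_inv_into[OF ob]] by (auto simp: o'_def bij_betw_inv_into_right)
  have a1: "a' (farr F f) = f" if "f \<in> Arr C" for f
    using that arr by (simp add: a'_def bij_betw_inv_into_left)
  have a2: "farr F (a' g) = g" "a' g \<in> Arr C" if "g \<in> Arr D" for g
    using that arr bij_betw_apply[OF bij_betw_inv_into[OF arr]] by (auto simp: a'_def bij_betw_inv_into_right)
  note F' = F[unfolded is_functor_def]
  have dc: "Dom C (a' g) = o' (Dom D g)" "Cod C (a' g) = o' (Cod D g)" if "g \<in> Arr D" for g
  proof -
    have "Dom D g = fobj F (Dom C (a' g))" "Cod D g = fobj F (Cod C (a' g))"
      using F' a2[OF that] by metis+
    then show "Dom C (a' g) = o' (Dom D g)" "Cod C (a' g) = o' (Cod D g)"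
      using o1 a2(2)[OF that] C.dom_in C.cod_in by auto
  qed
  have idn: "a' (Idn D Y) = Idn C (o' Y)" if "Y \<in> Ob D" for Y
  proof -
    have "farr F (Idn C (o' Y)) = Idn D Y" using functor_idn[OF F o2(2)[OF that]] o2(1)[OF that] by simp
    then show ?thesis using a1[of "Idn C (o' Y)"] C.idn_arr(1)[OF o2(2)[OF that]] by simp
  qed
  have comp: "a' (g \<cdot>\<^bsub>D\<^esub> f) = a' g \<cdot>\<^bsub>C\<^esub> a' f" if fg: "f \<in> Arr D" "g \<in> Arr D" "Cod D f = Dom D g" for f g
  proof -
    have e: "Cod C (a' f) = Dom C (a' g)" using dc fg by simp
    have "farr F (a' g \<cdot>\<^bsub>C\<^esub> a' f) = g \<cdot>\<^bsub>D\<^esub> f"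
      using functor_comp[OF F homI[OF a2(2)[OF fg(1)] refl refl] homI[OF a2(2)[OF fg(2)] e[symmetric] refl]]
        a2 fg by simp
    then show ?thesis using a1[of "a' g \<cdot>\<^bsub>C\<^esub> a' f"] C.comp_arr(1)[OF a2(2)[OF fg(1)] a2(2)[OF fg(2)] e] by simp
  qed
  define G where "G = \<lparr>fobj = \<lambda>Y \<in> Ob D. o' Y, farr = \<lambda>g \<in> Arr D. a' g\<rparr>"
  have G: "is_functor D C G"
    unfolding is_functor_def G_def
    using C.category_axioms D.category_axioms o2(2) a2(2) dc idn comp D.dom_in D.cod_in D.idn_arr(1) D.comp_arr(1)
    by auto
  have Fo: "fobj F X \<in> Ob D" if "X \<in> Ob C" for X using functor_ob[OF F that] .
  have Fa: "farr F f \<in> Arr D" if "f \<in> Arr C" for f using F' that by auto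
  have "comp_functor C G F = id_functor C"
    using o1 a1 Fo Fa by (auto simp: comp_functor_def id_functor_def compose_def G_def intro!: restrict_ext)
  moreover have "comp_functor D F G = id_functor D"
    using o2 a2 by (auto simp: comp_functor_def id_functor_def compose_def G_def intro!: restrict_ext)
  ultimately show ?thesis using F G unfolding is_cat_iso_def by blast
qed

context power_model
begin

abbreviation "Theta \<equiv> comparison I C Weq"

lemma Theta_functor: "is_functor P.L (power_cat I L) Theta"
  and Theta_comp: "comp_functor P Theta (loc_functor P (power_arrows I Weq)) = power_functor I C (loc_functor C Weq)"
  using theI'[OF comparison_factorization[OF category_axioms Weq_Arr, of I]]
  unfolding comparison_def loc_factor_def by blast+

lemma Theta_ob:
  assumes "X \<in> I \<rightarrow>\<^sub>E Ob C"
  shows "fobj Theta X = X"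
proof -
  have "fobj Theta X = fobj (comp_functor P Theta (loc_functor P (power_arrows I Weq))) X"
    using assms by (simp add: comp_functor_def compose_def loc_functor_def power_cat_def)
  also have "\<dots> = (\<lambda>i\<in>I. X i)"
    unfolding Theta_comp using assms
    by (auto simp: power_functor_def power_cat_def loc_functor_def PiE_iff intro!: restrict_ext)
  finally show ?thesis using assms by (simp add: PiE_restrict)
qed

lemma Theta_loc:
  assumes "f \<in> hom P X Y" "i \<in> I"
  shows "farr Theta (P.loc f) i = loc (f i)"
proof -
  have f: "f \<in> Arr P" using assms by (simp add: hom_def)
  have "farr Theta (P.loc f) = farr (comp_functor P Theta (loc_functor P (power_arrows I Weq))) f"
    using f by (simp add: comp_functor_def compose_def)
  then show ?thesis unfolding Theta_comp using f assms(2) by (simp add: power_functor_def)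
qed

lemma Theta_hom:
  assumes "a \<in> hom P.L X Y"
  shows "farr Theta a \<in> (\<Pi>\<^sub>E i\<in>I. hom L (X i) (Y i))"
proof -
  have XY: "X \<in> I \<rightarrow>\<^sub>E Ob C" "Y \<in> I \<rightarrow>\<^sub>E Ob C"
    using homD[OF assms] category.dom_in[OF P.L_cat, of a] category.cod_in[OF P.L_cat, of a]
    by (auto simp: loc_simps power_cat_def)
  then show ?thesis
    using functor_hom[OF Theta_functor assms] by (simp add: Theta_ob hom_power_iff loc_simps)
qed

text \<open>Cofibrant and fibrant replacements are weak equivalences, so \<open>a\<close> can be recovered from the
  conjugate \<open>\<gamma> j \<cdot> (a \<cdot> \<gamma> q)\<close>; \<open>\<Theta>\<close> takes it to the family of conjugates.\<close>

lemma Theta_conjugate: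
  assumes a: "a \<in> hom P.L X Y" and q: "q \<in> hom P Q X" and j: "j \<in> hom P Y Y'" and i: "i \<in> I"
  shows "farr Theta (P.loc j \<cdot>\<^bsub>P.L\<^esub> (a \<cdot>\<^bsub>P.L\<^esub> P.loc q)) i
    = loc (j i) \<cdot>\<^bsub>L\<^esub> (farr Theta a i \<cdot>\<^bsub>L\<^esub> loc (q i))"
  using functor_comp[OF Theta_functor category.comp_hom[OF P.L_cat P.loc_hom[OF q] a] P.loc_hom[OF j]]
    functor_comp[OF Theta_functor P.loc_hom[OF q] a] Theta_loc[OF q i] Theta_loc[OF j i] i
  by (simp add: power_comp_apply)

text \<open>Cofibrant and fibrant objects are defined by lifting, so replacements can be chosen one component
  at a time. The same family serves the power and its components in \<open>C\<close>.\<close>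

lemma replacements:
  assumes products: "has_finite_products C" and coproducts: "has_finite_coproducts C"
    and X: "X \<in> I \<rightarrow>\<^sub>E Ob C"
  obtains Q q j where "q \<in> power_arrows I Weq" "q \<in> hom P Q X" "P.cofibrant Q" "\<And>i. i \<in> I \<Longrightarrow> cofibrant (Q i)"
    "P.fibrant_replacement X j" "\<And>i. i \<in> I \<Longrightarrow> fibrant_replacement (X i) (j i)"
proof -
  have Xi: "X i \<in> Ob C" if "i \<in> I" for i using X that by auto
  have "\<forall>i. \<exists>q. i \<in> I \<longrightarrow> cofibrant_replacement (X i) q"
    using cofibrant_replacement_exists[OF coproducts Xi] by metis
  then obtain q0 where q0: "\<And>i. i \<in> I \<Longrightarrow> cofibrant_replacement (X i) (q0 i)" by metis
  have "\<forall>i. \<exists>j. i \<in> I \<longrightarrow> fibrant_replacement (X i) j"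
    using fibrant_replacement_exists[OF products Xi] by metis
  then obtain j0 where j0: "\<And>i. i \<in> I \<Longrightarrow> fibrant_replacement (X i) (j0 i)" by metis
  define q where "q = restrict q0 I"
  define j where "j = restrict j0 I"
  define Q where "Q = (\<lambda>i\<in>I. Dom C (q i))"
  define R where "R = (\<lambda>i\<in>I. Cod C (j i))"
  have qi: "q i \<in> TFib" "Cod C (q i) = X i" "cofibrant (Q i)" "q i \<in> hom C (Q i) (X i)" if "i \<in> I" for i
    using q0[OF that] that Fib_Arr by (auto simp: q_def Q_def cofibrant_replacement_def hom_def)
  have ji: "j i \<in> TCofib" "fibrant (R i)" "j i \<in> hom C (X i) (R i)" if "i \<in> I" for i
    using j0[OF that] that Cofib_Arr by (auto simp: j_def R_def fibrant_replacement_def hom_def)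
  have QR: "Q \<in> I \<rightarrow>\<^sub>E Ob C" "R \<in> I \<rightarrow>\<^sub>E Ob C"
    using qi(3) ji(2) by (auto simp: Q_def R_def cofibrant_def fibrant_def)
  have "q \<in> hom P Q X" using power_homI[OF QR(1) X, of q] qi(4) by (simp add: q_def)
  moreover have jh: "j \<in> hom P X R" using power_homI[OF X QR(2), of j] ji(3) by (simp add: j_def)
  moreover have "q \<in> power_arrows I Weq" using qi(1) by (auto simp: power_arrows_def q_def)
  moreover have "P.cofibrant Q" using power_cofibrant[OF QR(1) qi(3)] .
  moreover have "j \<in> power_arrows I Cofib \<inter> power_arrows I Weq"
    using ji(1) by (auto simp: power_arrows_def j_def)
  then have "P.fibrant_replacement X j"
    using power_fibrant[OF QR(2) ji(2)] homD[OF jh] unfolding P.fibrant_replacement_def by simp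
  moreover have "fibrant_replacement (X i) (j i)" if "i \<in> I" for i using j0[OF that] that by (simp add: j_def)
  ultimately show thesis using that qi(3) by blast
qed

text \<open>The conjugate of each \<open>b i\<close> is the image of an arrow \<open>f i\<close>. The image of the family \<open>f\<close> in the
  homotopy category of the power, conjugated back, is the preimage of \<open>b\<close>.\<close>

lemma Theta_full:
  assumes products: "has_finite_products C" and coproducts: "has_finite_coproducts C"
    and X: "X \<in> I \<rightarrow>\<^sub>E Ob C" and Y: "Y \<in> I \<rightarrow>\<^sub>E Ob C" and b: "b \<in> (\<Pi>\<^sub>E i\<in>I. hom L (X i) (Y i))"
  obtains a where "a \<in> hom P.L X Y" "farr Theta a = b"
proof -
  interpret L: category L by (rule L_cat)
  obtain Q q where q: "q \<in> power_arrows I Weq" "q \<in> hom P Q X" "\<And>i. i \<in> I \<Longrightarrow> cofibrant (Q i)"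
    using replacements[OF products coproducts X] by metis
  obtain j where j: "P.fibrant_replacement Y j" "\<And>i. i \<in> I \<Longrightarrow> fibrant_replacement (Y i) (j i)"
    using replacements[OF products coproducts Y] by metis
  define Y' where "Y' = Cod P j"
  have jW: "j \<in> power_arrows I Weq" and jh: "j \<in> hom P Y Y'"
    using j(1) P.Cofib_Arr by (auto simp: P.fibrant_replacement_def hom_def Y'_def)
  have qi: "q i \<in> hom C (Q i) (X i)" "q i \<in> Weq" and ji: "j i \<in> hom C (Y i) (Y' i)" "j i \<in> Weq" if "i \<in> I" for i
    using power_hom_component[OF q(2) that] power_hom_component[OF jh that] q(1) jW that
    by (auto simp: power_arrows_def PiE_iff)
  have bi: "b i \<in> hom L (X i) (Y i)" if "i \<in> I" for i using b that by auto
  have R: "\<exists>j. fibrant_replacement Y j" if "Y \<in> Ob C" for Y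
    using fibrant_replacement_exists[OF products that] by metis
  have "\<exists>f. f \<in> hom C (Q i) (Y' i) \<and> loc f = loc (j i) \<cdot>\<^bsub>L\<^esub> (b i \<cdot>\<^bsub>L\<^esub> loc (q i))" if i: "i \<in> I" for i
  proof -
    have "Cod C (j i) = Y' i" using ji(1)[OF i] by (simp add: hom_def)
    then show ?thesis
      using loc_arrow_representable[OF q(3)[OF i] R L.comp_hom[OF loc_hom[OF qi(1)[OF i]] bi[OF i]] j(2)[OF i]]
      by metis
  qed
  then obtain f0 where f0: "\<And>i. i \<in> I \<Longrightarrow> f0 i \<in> hom C (Q i) (Y' i) \<and> loc (f0 i) = loc (j i) \<cdot>\<^bsub>L\<^esub> (b i \<cdot>\<^bsub>L\<^esub> loc (q i))"
    by metis
  define f where "f = restrict f0 I"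
  have "Q \<in> Ob P" "Y' \<in> Ob P" using q(2) jh P.dom_in P.cod_in by (auto simp: hom_def)
  then have f: "f \<in> hom P Q Y'" using f0 by (intro power_homI) (auto simp: f_def power_cat_def)
  obtain a where a: "a \<in> hom P.L X Y" "P.loc j \<cdot>\<^bsub>P.L\<^esub> (a \<cdot>\<^bsub>P.L\<^esub> P.loc q) = P.loc f"
    using category.iso_divide[OF P.L_cat P.loc_iso[OF q(1)] P.loc_hom[OF q(2)] P.loc_iso[OF jW] P.loc_hom[OF jh] P.loc_hom[OF f]] .
  have "farr Theta a i = b i" if i: "i \<in> I" for i
  proof -
    have ai: "farr Theta a i \<in> hom L (X i) (Y i)" using Theta_hom[OF a(1)] i by auto
    have "loc (j i) \<cdot>\<^bsub>L\<^esub> (farr Theta a i \<cdot>\<^bsub>L\<^esub> loc (q i)) = loc (j i) \<cdot>\<^bsub>L\<^esub> (b i \<cdot>\<^bsub>L\<^esub> loc (q i))"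
      using Theta_conjugate[OF a(1) q(2) jh i] a(2) Theta_loc[OF f i] f0[OF i] i by (simp add: f_def)
    note L.iso_cancel_left[OF loc_iso[OF ji(2)[OF i]] loc_hom[OF ji(1)[OF i]]
      L.comp_hom[OF loc_hom[OF qi(1)[OF i]] ai] L.comp_hom[OF loc_hom[OF qi(1)[OF i]] bi[OF i]] this]
    from L.iso_cancel_right[OF loc_iso[OF qi(2)[OF i]] loc_hom[OF qi(1)[OF i]] ai bi[OF i] this] show ?thesis .
  qed
  then have "farr Theta a = b" using PiE_ext[OF Theta_hom[OF a(1)] b] by blast
  then show thesis using that a(1) by blast
qed

text \<open>Conjugates of \<open>a\<close> and \<open>b\<close> by the same replacements are images of arrows \<open>f\<close> and \<open>g\<close> of the
  power whose components agree in the homotopy category of \<open>C\<close>. The resulting left homotopies form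
  one left homotopy in the power.\<close>

lemma Theta_faithful:
  assumes products: "has_finite_products C" and coproducts: "has_finite_coproducts C"
    and a: "a \<in> hom P.L X Y" and b: "b \<in> hom P.L X Y" and eq: "farr Theta a = farr Theta b"
  shows "a = b"
proof -
  interpret PL: category P.L by (rule P.L_cat)
  have X: "X \<in> I \<rightarrow>\<^sub>E Ob C" and Y: "Y \<in> I \<rightarrow>\<^sub>E Ob C"
    using homD[OF a] PL.dom_in[of a] PL.cod_in[of a] by (auto simp: loc_simps power_cat_def)
  obtain Q q where q: "q \<in> power_arrows I Weq" "q \<in> hom P Q X" "P.cofibrant Q" "\<And>i. i \<in> I \<Longrightarrow> cofibrant (Q i)"
    using replacements[OF products coproducts X] by metis
  obtain j where j: "P.fibrant_replacement Y j"
    using replacements[OF products coproducts Y] by metis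
  define Y' where "Y' = Cod P j"
  have jW: "j \<in> power_arrows I Weq" and jh: "j \<in> hom P Y Y'"
    using j P.Cofib_Arr by (auto simp: P.fibrant_replacement_def hom_def Y'_def)
  have R: "\<exists>j. P.fibrant_replacement Z j" if "Z \<in> Ob P" for Z
    using replacements[OF products coproducts, of Z] that by (simp add: power_cat_def) metis
  note rep = P.loc_arrow_representable[OF q(3) R PL.comp_hom[OF P.loc_hom[OF q(2)]] j, folded Y'_def]
  obtain f where f: "f \<in> hom P Q Y'" "P.loc f = P.loc j \<cdot>\<^bsub>P.L\<^esub> (a \<cdot>\<^bsub>P.L\<^esub> P.loc q)" using rep[OF _ a] .
  obtain g where g: "g \<in> hom P Q Y'" "P.loc g = P.loc j \<cdot>\<^bsub>P.L\<^esub> (b \<cdot>\<^bsub>P.L\<^esub> P.loc q)" using rep[OF _ b] .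
  \<comment> \<open>A left homotopy from \<open>t \<cdot> f i\<close> to \<open>t \<cdot> g i\<close>; the cylinder is \<open>Dom C s\<close> and the target \<open>Cod C t\<close>,
    which leaves only arrows to be chosen.\<close>
  define homotopy where "homotopy i t k l s H \<longleftrightarrow> t \<in> Weq \<and> t \<in> hom C (Y' i) (Cod C t) \<and>
      k \<in> hom C (Q i) (Dom C s) \<and> l \<in> hom C (Q i) (Dom C s) \<and> s \<in> Weq \<and> s \<in> hom C (Dom C s) (Q i) \<and>
      s \<cdot> k = s \<cdot> l \<and> H \<in> hom C (Dom C s) (Cod C t) \<and> H \<cdot> k = t \<cdot> f i \<and> H \<cdot> l = t \<cdot> g i" for i t k l s H
  have "\<exists>t k l s H. homotopy i t k l s H" if i: "i \<in> I" for i
  proof -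
    have fi: "f i \<in> hom C (Q i) (Y' i)" and gi: "g i \<in> hom C (Q i) (Y' i)"
      using power_hom_component[OF f(1) i] power_hom_component[OF g(1) i] .
    have "loc (f i) = loc (g i)"
      using Theta_loc[OF f(1) i] Theta_loc[OF g(1) i] f(2) g(2) eq
        Theta_conjugate[OF a q(2) jh i] Theta_conjugate[OF b q(2) jh i] by simp
    from loc_eq_imp_homotopic[OF products coproducts q(4)[OF i] fi gi this]
    obtain t Z T k l s H where h: "t \<in> Weq" "t \<in> hom C (Y' i) Z" "k \<in> hom C (Q i) T" "l \<in> hom C (Q i) T"
      "s \<in> Weq" "s \<in> hom C T (Q i)" "s \<cdot> k = Idn C (Q i)" "s \<cdot> l = Idn C (Q i)"
      "H \<in> hom C T Z" "H \<cdot> k = t \<cdot> f i" "H \<cdot> l = t \<cdot> g i" .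
    moreover have "Cod C t = Z" "Dom C s = T" using h by (auto simp: hom_def)
    ultimately have "homotopy i t k l s H" unfolding homotopy_def by simp
    then show ?thesis by blast
  qed
  then obtain t0 k0 l0 s0 H0 where h0: "\<And>i. i \<in> I \<Longrightarrow> homotopy i (t0 i) (k0 i) (l0 i) (s0 i) (H0 i)" by metis
  define t k l s H where fam: "t = restrict t0 I" "k = restrict k0 I" "l = restrict l0 I" "s = restrict s0 I"
    "H = restrict H0 I"
  define Z T where "Z = (\<lambda>i\<in>I. Cod C (t i))" and "T = (\<lambda>i\<in>I. Dom C (s i))"
  have h: "t i \<in> Weq" "t i \<in> hom C (Y' i) (Z i)" "k i \<in> hom C (Q i) (T i)" "l i \<in> hom C (Q i) (T i)"
    "s i \<in> Weq" "s i \<in> hom C (T i) (Q i)" "s i \<cdot> k i = s i \<cdot> l i" "H i \<in> hom C (T i) (Z i)"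
    "H i \<cdot> k i = t i \<cdot> f i" "H i \<cdot> l i = t i \<cdot> g i" if "i \<in> I" for i
    using h0[OF that] that by (simp_all add: homotopy_def fam Z_def T_def)
  have Q: "Q \<in> I \<rightarrow>\<^sub>E Ob C" and Y': "Y' \<in> I \<rightarrow>\<^sub>E Ob C"
    using homD[OF q(2)] homD[OF jh] P.dom_in[of q] P.cod_in[of j] by (auto simp: power_cat_def)
  have Z: "Z \<in> I \<rightarrow>\<^sub>E Ob C" and T: "T \<in> I \<rightarrow>\<^sub>E Ob C"
    using h(2,6) dom_in cod_in by (auto simp: Z_def T_def hom_def)
  have ext: "t \<in> extensional I" "k \<in> extensional I" "l \<in> extensional I" "s \<in> extensional I"
    "H \<in> extensional I"
    by (simp_all add: fam)
  have th: "t \<in> hom P Y' Z" by (rule power_homI[OF Y' Z ext(1) h(2)])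
  have kh: "k \<in> hom P Q T" by (rule power_homI[OF Q T ext(2) h(3)])
  have lh: "l \<in> hom P Q T" by (rule power_homI[OF Q T ext(3) h(4)])
  have sh: "s \<in> hom P T Q" by (rule power_homI[OF T Q ext(4) h(6)])
  have Hh: "H \<in> hom P T Z" by (rule power_homI[OF T Z ext(5) h(8)])
  have W: "t \<in> power_arrows I Weq" "s \<in> power_arrows I Weq" using h(1,5) by (auto simp: power_arrows_def fam)
  have sk: "s \<cdot>\<^bsub>P\<^esub> k = s \<cdot>\<^bsub>P\<^esub> l"
    by (rule power_arr_eqI[OF P.comp_hom[OF kh sh] P.comp_hom[OF lh sh]]) (simp add: power_comp_apply h(7))
  have Hk: "H \<cdot>\<^bsub>P\<^esub> k = t \<cdot>\<^bsub>P\<^esub> f"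
    by (rule power_arr_eqI[OF P.comp_hom[OF kh Hh] P.comp_hom[OF f(1) th]]) (simp add: power_comp_apply h(9))
  have Hl: "H \<cdot>\<^bsub>P\<^esub> l = t \<cdot>\<^bsub>P\<^esub> g"
    by (rule power_arr_eqI[OF P.comp_hom[OF lh Hh] P.comp_hom[OF g(1) th]]) (simp add: power_comp_apply h(10))
  have "P.loc f = P.loc g"
    by (rule P.homotopic_imp_loc_eq[OF f(1) g(1) W(1) th kh lh W(2) sh sk Hh Hk Hl])
  then have "P.loc j \<cdot>\<^bsub>P.L\<^esub> (a \<cdot>\<^bsub>P.L\<^esub> P.loc q) = P.loc j \<cdot>\<^bsub>P.L\<^esub> (b \<cdot>\<^bsub>P.L\<^esub> P.loc q)"
    using f(2) g(2) by simp
  note PL.iso_cancel_left[OF P.loc_iso[OF jW] P.loc_hom[OF jh]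
    PL.comp_hom[OF P.loc_hom[OF q(2)] a] PL.comp_hom[OF P.loc_hom[OF q(2)] b] this]
  from PL.iso_cancel_right[OF P.loc_iso[OF q(1)] P.loc_hom[OF q(2)] a b this] show ?thesis .
qed

lemma Theta_bij_hom:
  assumes products: "has_finite_products C" and coproducts: "has_finite_coproducts C"
    and X: "X \<in> I \<rightarrow>\<^sub>E Ob C" and Y: "Y \<in> I \<rightarrow>\<^sub>E Ob C"
  shows "bij_betw (farr Theta) (hom P.L X Y) (\<Pi>\<^sub>E i\<in>I. hom L (X i) (Y i))"
  unfolding bij_betw_def
proof (intro conjI inj_onI equalityI subsetI)
  show "a = b" if "a \<in> hom P.L X Y" "b \<in> hom P.L X Y" "farr Theta a = farr Theta b" for a b
    using Theta_faithful[OF products coproducts that] .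
  show "b \<in> (\<Pi>\<^sub>E i\<in>I. hom L (X i) (Y i))" if "b \<in> farr Theta ` hom P.L X Y" for b
    using that Theta_hom by blast
  show "b \<in> farr Theta ` hom P.L X Y" if b: "b \<in> (\<Pi>\<^sub>E i\<in>I. hom L (X i) (Y i))" for b
  proof -
    obtain a where "a \<in> hom P.L X Y" "farr Theta a = b" using Theta_full[OF products coproducts X Y b] .
    then show ?thesis by blast
  qed
qed

lemma Theta_iso:
  assumes products: "has_finite_products C" and coproducts: "has_finite_coproducts C"
  shows "is_cat_iso P.L (power_cat I L) Theta"
proof (rule cat_isoI[OF Theta_functor])
  interpret PL: category P.L by (rule P.L_cat)
  interpret LP: category "power_cat I L" by (rule category_power[OF L_cat])
  have obs: "Ob P.L = I \<rightarrow>\<^sub>E Ob C" "Ob (power_cat I L) = I \<rightarrow>\<^sub>E Ob C"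
    by (simp_all add: loc_simps power_cat_def)
  show "bij_betw (fobj Theta) (Ob P.L) (Ob (power_cat I L))"
    unfolding obs by (rule bij_betw_cong[THEN iffD2, OF Theta_ob bij_betw_id[unfolded id_def]])
  show "bij_betw (farr Theta) (Arr P.L) (Arr (power_cat I L))"
    unfolding bij_betw_def
  proof (intro conjI inj_onI equalityI subsetI)
    fix a b assume a: "a \<in> Arr P.L" and b: "b \<in> Arr P.L" and eq: "farr Theta a = farr Theta b"
    have "Dom (power_cat I L) (farr Theta c) = Dom P.L c \<and> Cod (power_cat I L) (farr Theta c) = Cod P.L c"
      if "c \<in> Arr P.L" for c
      using Theta_functor that PL.dom_in[OF that] PL.cod_in[OF that] Theta_ob unfolding obs is_functor_def by auto
    from this[OF a] this[OF b] have "b \<in> hom P.L (Dom P.L a) (Cod P.L a)" using b eq by (simp add: hom_def)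
    then show "a = b" using Theta_faithful[OF products coproducts _ _ eq] a by (simp add: hom_def)
  next
    fix b assume "b \<in> farr Theta ` Arr P.L"
    then show "b \<in> Arr (power_cat I L)" using Theta_functor by (auto simp: is_functor_def)
  next
    fix b assume b: "b \<in> Arr (power_cat I L)"
    let ?X = "Dom (power_cat I L) b" and ?Y = "Cod (power_cat I L) b"
    have XY: "?X \<in> I \<rightarrow>\<^sub>E Ob L" "?Y \<in> I \<rightarrow>\<^sub>E Ob L" using LP.dom_in[OF b] LP.cod_in[OF b] by (simp_all add: power_cat_def)
    have "b \<in> (\<Pi>\<^sub>E i\<in>I. hom L (?X i) (?Y i))" using hom_power_iff[OF XY] homI[OF b refl refl] by blast
    from Theta_full[OF products coproducts XY[unfolded loc_simps(1)] this]
    obtain a where "a \<in> hom P.L ?X ?Y" "farr Theta a = b" .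
    then show "b \<in> farr Theta ` Arr P.L" by (auto simp: hom_def)
  qed
qed

end

theorem theorem6p8:
  fixes A :: "('o, 'm) cat" and Cofib Fib Weq :: "'m set" and I :: "'i set"
  assumes "category A"
    and "has_finite_products A"
    and "has_finite_coproducts A"
    and "model_structure A Cofib Fib Weq"
  shows "is_functor (Ho (power_cat I A) (power_arrows I Weq)) (power_cat I (Ho A Weq)) (\<Theta> I A Weq) \<and>
    comp_functor (power_cat I A) (\<Theta> I A Weq) (\<gamma> (power_cat I A) (power_arrows I Weq))
      = power_functor I A (\<gamma> A Weq) \<and>
    is_cat_iso (Ho (power_cat I A) (power_arrows I Weq)) (power_cat I (Ho A Weq)) (\<Theta> I A Weq) \<and>
    (\<forall>X \<in> I \<rightarrow>\<^sub>E Ob A. \<forall>Y \<in> I \<rightarrow>\<^sub>E Ob A.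
      bij_betw (farr (\<Theta> I A Weq))
        (hom (Ho (power_cat I A) (power_arrows I Weq))
          (fobj (\<gamma> (power_cat I A) (power_arrows I Weq)) X)
          (fobj (\<gamma> (power_cat I A) (power_arrows I Weq)) Y))
        (\<Pi>\<^sub>E i\<in>I. hom (Ho A Weq) (fobj (\<gamma> A Weq) (X i)) (fobj (\<gamma> A Weq) (Y i))))"
proof (intro conjI ballI)
  interpret power_model A Cofib Fib Weq I
    using assms(4) by (simp add: power_model_def)
  show "is_functor (Ho (power_cat I A) (power_arrows I Weq)) (power_cat I (Ho A Weq)) (\<Theta> I A Weq)"
    by (rule Theta_functor)
  show "comp_functor (power_cat I A) (\<Theta> I A Weq) (\<gamma> (power_cat I A) (power_arrows I Weq))
      = power_functor I A (\<gamma> A Weq)"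
    by (rule Theta_comp)
  show "is_cat_iso (Ho (power_cat I A) (power_arrows I Weq)) (power_cat I (Ho A Weq)) (\<Theta> I A Weq)"
    by (rule Theta_iso[OF assms(2,3)])
  fix X Y assume X: "X \<in> I \<rightarrow>\<^sub>E Ob A" and Y: "Y \<in> I \<rightarrow>\<^sub>E Ob A"
  have "fobj (\<gamma> (power_cat I A) (power_arrows I Weq)) Z = Z" if "Z \<in> I \<rightarrow>\<^sub>E Ob A" for Z
    using that by (simp add: loc_functor_def power_cat_def)
  moreover have "(\<Pi>\<^sub>E i\<in>I. hom (Ho A Weq) (fobj (\<gamma> A Weq) (X i)) (fobj (\<gamma> A Weq) (Y i)))
      = (\<Pi>\<^sub>E i\<in>I. hom (Ho A Weq) (X i) (Y i))"
    using X Y by (intro PiE_cong) (auto simp: loc_functor_def)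
  ultimately show "bij_betw (farr (\<Theta> I A Weq))
        (hom (Ho (power_cat I A) (power_arrows I Weq))
          (fobj (\<gamma> (power_cat I A) (power_arrows I Weq)) X)
          (fobj (\<gamma> (power_cat I A) (power_arrows I Weq)) Y))
        (\<Pi>\<^sub>E i\<in>I. hom (Ho A Weq) (fobj (\<gamma> A Weq) (X i)) (fobj (\<gamma> A Weq) (Y i)))"
    using Theta_bij_hom[OF assms(2,3) X Y] X Y by simp
qed

end
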